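(* Let $S=\bigoplus_{i\ge1}S_i$ be a graded associative algebra over $\mathbb{K}$. Identify $\mathfrak{s}=\bigoplus_{i\ge1}\mathcal{J}^g_i(S)/\mathcal{J}^g_{i+1}(S)$ with $S=\bigoplus_{i\ge 1}S_i$ via $(1+\alpha_i)\mathcal{J}^g_{i+1}(S)\leftrightarrow\alpha_i$ ($\alpha_i\in S_i$). Then the Sabinin brackets $\langle -;-,-\rangle$ determined by the N-sequence $\mathcal{J}^g_1(S)\supseteq\mathcal{J}^g_2(S)\supseteq\cdots$ are given, for $m\ge1$, $a_j\in S_{i_j}$ ($j=1,\dots,m$) and $b,c\in S$, by $$\langle a_1,\dots,a_m;b,c\rangle=\sum_{k\ge 1}\ \sum_{(B_1,\dots,B_k)}(-1)^{k+1}\,|B_k|\,N(B_1)\cdots N(B_k)\;a_{B_1}\cdots a_{B_k}\,[c,b],$$ where the inner sum runs over all ordered $k$-tuples $(B_1,\dots,B_k)$ of pairwise disjoint nonempty subsets of $\{1,\dots,m\}$ with union $\{1,\dots,m\}$, $[c,b]:=cb-bc$, and for $B=\{j_1<\dots<j_r\}$ $$|B|:=i_{j_1}+\cdots+i_{j_r},\qquad a_B:=a_{j_1}a_{j_2}\cdots a_{j_r},$$ $$N(B):=(i_{j_1}+1)(i_{j_1}+i_{j_2}+1)\cdots(i_{j_1}+\cdots+i_{j_r}+1).$$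
   Context: $\mathbb{K}$ is a field of characteristic zero. $\hat S=\prod_{n\ge 1}S_n$, and $\mathcal{J}^g(S)=1+\hat S$ is a loop with unit $1$ under $$\Big(\sum_{m\ge 0}\alpha_m\Big)\circ\Big(\sum_{n\ge 0}\beta_n\Big):=\sum_{m\ge 0}\alpha_m\Big(\sum_{n\ge 0}\beta_n\Big)^{m+1}\qquad(\alpha_0=\beta_0=1,\ \alpha_n,\beta_n\in S_n).$$ For $i\ge1$, $\mathcal{J}^g_i(S):=\{1+\sum_{k\ge i}\alpha_k\mid\alpha_k\in S_k\}$, a normal subloop; $\mathcal{J}^g_i(S)/\mathcal{J}^g_{i+1}(S)$ is an abelian group isomorphic to $(S_i,+)$ and is given the $\mathbb{K}$-vector space structure of $S_i$. In a loop with product $\circ$, left division is $x\backslash y=L_x^{-1}(y)$, where $L_x(y)=x\circ y$. The associator is $(a,b,c)=(a\circ(b\circ c))\backslash((a\circ b)\circ c)$, and its deviations are defined recursively, for $n\ge1$ and $1\le i_n\le n+2$, by $$(a_1,\dots,a_{n+3})_{i_1,\dots,i_n}:=\big(A(a_{i_n})\circ A(a_{i_n+1})\big)\backslash A(a_{i_n}\circ a_{i_n+1}),$$ where $A(a):=(a_1,\dots,a_{i_n-1},a,a_{i_n+2},\dots,a_{n+3})_{i_1,\dots,i_{n-1}}$ (for $n=1$ this is the associator). For $m\ge1$ put $$P_{m,1}(x_1,\dots,x_m;y;z):=(x_1,\dots,x_m,y,z)_{1,\dots,1}\qquad(m-1\text{ indices equal to }1),$$ so $P_{1,1}(x;y;z)=(x,y,z)$.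 The filtration $(\mathcal{J}^g_i(S))_{i\ge1}$ is an N-sequence (in particular $P_{m,1}$ maps $\mathcal{J}^g_{i_1}(S)\times\cdots\times\mathcal{J}^g_{i_{m+2}}(S)$ into $\mathcal{J}^g_{i_1+\cdots+i_{m+2}}(S)$), and $P_{m,1}$ induces a graded $\mathbb{K}$-multilinear operation $p_{m,1}$ on $\mathfrak{s}\cong S$: for homogeneous $a_j\in S_{i_j}$, $b\in S_j$, $c\in S_k$, $p_{m,1}(a_1,\dots,a_m;b;c)$ is the component of degree $i_1+\cdots+i_m+j+k$ of $P_{m,1}(1+a_1,\dots,1+a_m;1+b;1+c)$. The Sabinin brackets determined by the N-sequence are $$\langle a_1,\dots,a_m;b,c\rangle:=p_{m,1}(a_1,\dots,a_m;c;b)-p_{m,1}(a_1,\dots,a_m;b;c).$$ *)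

theory Defs
  imports Complex_Main "HOL-Library.Product_Plus"
begin

text \<open>
  The whole type \<open>'a\<close> is the graded associative algebra \<open>S\<close> over the field \<open>'k\<close>; it is not
  assumed to have a unit (class \<open>ring\<close>). Only the values \<open>S n\<close> for \<open>n \<ge> 1\<close> are relevant.
\<close>

definition homogeneous_decomposition ::
    "(nat \<Rightarrow> 'a::comm_monoid_add set) \<Rightarrow> 'a \<Rightarrow> (nat \<Rightarrow> 'a) \<Rightarrow> bool" where
  "homogeneous_decomposition S x f \<longleftrightarrow>
     finite {n. f n \<noteq> 0} \<and> f 0 = 0 \<and> (\<forall>n\<ge>1. f n \<in> S n) \<and> x = (\<Sum>n | f n \<noteq> 0. f n)"

locale graded_algebra = vector_space scale
  for scale :: "'k::field_char_0 \<Rightarrow> 'a::ring \<Rightarrow> 'a" +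
  fixes S :: "nat \<Rightarrow> 'a set"
  assumes scale_mult_left: "scale k (x * y) = scale k x * y"
    and scale_mult_right: "scale k (x * y) = x * scale k y"
    and subspace_S: "n \<ge> 1 \<Longrightarrow> subspace (S n)"
    and mult_S: "m \<ge> 1 \<Longrightarrow> n \<ge> 1 \<Longrightarrow> x \<in> S m \<Longrightarrow> y \<in> S n \<Longrightarrow> x * y \<in> S (m + n)"
    and direct_sum_S: "\<exists>!f. homogeneous_decomposition S x f"
begin

definition component :: "nat \<Rightarrow> 'a \<Rightarrow> 'a" where
  "component n x = (THE f. homogeneous_decomposition S x f) n"

definition degrees :: "'a \<Rightarrow> nat set" where
  "degrees x = {n. component n x \<noteq> 0}"

subsection \<open>The loop of formal series with constant term one\<close>

text \<open>
  A pair \<open>(k, x)\<close> stands for \<open>k + x\<close> in the unital hull \<open>K \<oplus> S\<close>. A formal series is the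
  sequence of its homogeneous components, the component of degree \<open>0\<close> being a scalar.
\<close>

definition umult :: "'k \<times> 'a \<Rightarrow> 'k \<times> 'a \<Rightarrow> 'k \<times> 'a" where
  "umult u v = (fst u * fst v, scale (fst u) (snd v) + scale (fst v) (snd u) + snd u * snd v)"

definition sone :: "nat \<Rightarrow> 'k \<times> 'a" where
  "sone n = (if n = 0 then (1, 0) else 0)"

definition smult :: "(nat \<Rightarrow> 'k \<times> 'a) \<Rightarrow> (nat \<Rightarrow> 'k \<times> 'a) \<Rightarrow> nat \<Rightarrow> 'k \<times> 'a" where
  "smult u v n = (\<Sum>i\<le>n. umult (u i) (v (n - i)))"

definition spow :: "(nat \<Rightarrow> 'k \<times> 'a) \<Rightarrow> nat \<Rightarrow> nat \<Rightarrow> 'k \<times> 'a" where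
  "spow u k = (smult u ^^ k) sone"

definition J :: "nat \<Rightarrow> (nat \<Rightarrow> 'k \<times> 'a) set" where
  "J i = {u. u 0 = (1, 0) \<and> (\<forall>n\<ge>1. fst (u n) = 0 \<and> snd (u n) \<in> S n) \<and>
             (\<forall>n. 1 \<le> n \<and> n < i \<longrightarrow> u n = 0)}"

text \<open>
  The component of degree \<open>n\<close> of \<open>\<Sum>m. \<alpha>\<^sub>m (\<Sum>j. \<beta>\<^sub>j)\<^bsup>m+1\<^esup>\<close>; since \<open>\<alpha>\<^sub>m\<close> has degree \<open>m\<close>, only the
  terms with \<open>m \<le> n\<close> contribute.
\<close>

definition comp :: "(nat \<Rightarrow> 'k \<times> 'a) \<Rightarrow> (nat \<Rightarrow> 'k \<times> 'a) \<Rightarrow> nat \<Rightarrow> 'k \<times> 'a" where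
  "comp \<alpha> \<beta> n = (\<Sum>m\<le>n. umult (\<alpha> m) (spow \<beta> (m + 1) (n - m)))"

definition ldiv :: "(nat \<Rightarrow> 'k \<times> 'a) \<Rightarrow> (nat \<Rightarrow> 'k \<times> 'a) \<Rightarrow> nat \<Rightarrow> 'k \<times> 'a" where
  "ldiv x y = inv_into (J 1) (comp x) y"

definition associator ::
    "(nat \<Rightarrow> 'k \<times> 'a) \<Rightarrow> (nat \<Rightarrow> 'k \<times> 'a) \<Rightarrow> (nat \<Rightarrow> 'k \<times> 'a) \<Rightarrow> nat \<Rightarrow> 'k \<times> 'a" where
  "associator a b c = ldiv (comp a (comp b c)) (comp (comp a b) c)"

text \<open>
  The first argument lists the indices in reverse order, \<open>[i\<^sub>n, \<dots>, i\<^sub>1]\<close>; the second is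
  \<open>[a\<^sub>1, \<dots>, a\<^bsub>n+3\<^esub>]\<close>. The indices are \<open>1\<close>-based, as opposed to list positions.
\<close>

fun deviation_rev :: "nat list \<Rightarrow> (nat \<Rightarrow> 'k \<times> 'a) list \<Rightarrow> nat \<Rightarrow> 'k \<times> 'a" where
  "deviation_rev [] as = associator (as ! 0) (as ! 1) (as ! 2)"
| "deviation_rev (i # is) as =
     (let A = (\<lambda>a. deviation_rev is (take (i - 1) as @ [a] @ drop (i + 1) as));
          x = as ! (i - 1); y = as ! i
      in ldiv (comp (A x) (A y)) (A (comp x y)))"

definition deviation :: "nat list \<Rightarrow> (nat \<Rightarrow> 'k \<times> 'a) list \<Rightarrow> nat \<Rightarrow> 'k \<times> 'a" where
  "deviation is as = deviation_rev (rev is) as"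

text \<open>\<open>P xs y z\<close> is \<open>P\<^bsub>m,1\<^esub>(x\<^sub>1, \<dots>, x\<^sub>m; y; z)\<close> with \<open>m = length xs \<ge> 1\<close>.\<close>

definition P ::
    "(nat \<Rightarrow> 'k \<times> 'a) list \<Rightarrow> (nat \<Rightarrow> 'k \<times> 'a) \<Rightarrow> (nat \<Rightarrow> 'k \<times> 'a) \<Rightarrow> nat \<Rightarrow> 'k \<times> 'a" where
  "P xs y z = deviation (replicate (length xs - 1) 1) (xs @ [y, z])"

subsection \<open>The Sabinin brackets\<close>

text \<open>\<open>one_plus n x\<close> is the series \<open>1 + x\<close> for \<open>x \<in> S n\<close>, \<open>n \<ge> 1\<close>.\<close>

definition one_plus :: "nat \<Rightarrow> 'a \<Rightarrow> nat \<Rightarrow> 'k \<times> 'a" where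
  "one_plus n x = sone(n := (0, x))"

text \<open>
  The multilinear operation \<open>p\<^bsub>m,1\<^esub>\<close> on all of \<open>S\<close>: the arguments are split into their nonzero
  homogeneous components, \<open>ds\<close> running over the lists of the degrees chosen for the \<open>x\<^sub>j\<close>. On
  nonzero homogeneous arguments the sum has a single term.
\<close>

definition p :: "'a list \<Rightarrow> 'a \<Rightarrow> 'a \<Rightarrow> 'a" where
  "p xs y z =
     (\<Sum>ds \<in> listset (map degrees xs). \<Sum>j \<in> degrees y. \<Sum>k \<in> degrees z.
        snd (P (map2 (\<lambda>d x. one_plus d (component d x)) ds xs)
               (one_plus j (component j y)) (one_plus k (component k z))
               (sum_list ds + j + k)))"

definition sabinin_bracket :: "'a list \<Rightarrow> 'a \<Rightarrow> 'a \<Rightarrow> 'a" where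
  "sabinin_bracket as b c = p as c b - p as b c"

end

subsection \<open>Ordered set partitions and their coefficients\<close>

definition ordered_partitions :: "nat \<Rightarrow> 'b set \<Rightarrow> 'b set list set" where
  "ordered_partitions k A =
     {Bs. length Bs = k \<and> (\<forall>B\<in>set Bs. B \<noteq> {}) \<and> \<Union>(set Bs) = A \<and>
          (\<forall>q<k. \<forall>r<k. q \<noteq> r \<longrightarrow> Bs ! q \<inter> Bs ! r = {})}"

definition block_degree :: "(nat \<Rightarrow> nat) \<Rightarrow> nat set \<Rightarrow> nat" where
  "block_degree i B = (\<Sum>j\<in>B. i j)"

definition block_N :: "(nat \<Rightarrow> nat) \<Rightarrow> nat set \<Rightarrow> nat" where
  "block_N i B = (\<Prod>j\<in>B. (\<Sum>l | l \<in> B \<and> l \<le> j. i l) + 1)"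

text \<open>
  \<open>block_word a Bs x\<close> is \<open>a\<^bsub>B\<^sub>1\<^esub> \<cdots> a\<^bsub>B\<^sub>k\<^esub> x\<close>, bracketed to the right because there is no unit to
  start the product with.
\<close>

definition block_word :: "(nat \<Rightarrow> 'a::ring) \<Rightarrow> nat set list \<Rightarrow> 'a \<Rightarrow> 'a" where
  "block_word a Bs x = foldr (*) (map a (concat (map sorted_list_of_set Bs))) x"

end

theory Submission
  imports Defs
begin

text \<open>
  The bracket is read off from the lowest component of a deviation, but a deviation is assembled from
  left quotients whose higher components are not controlled by the degree alone. The computation is
  therefore carried out with independent letters, one for each argument, whose weights are the degrees
  of the arguments: formal series are functions from words to \<open>\<bbbK>\<close>, they form a loop under the same
  substitution product, and evaluating the letters respects sums, products, the loop product and left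
  division (\<open>eval_loop_mult\<close>, \<open>eval_loop_ldiv\<close>, \<open>eval_loop_deviation\<close>). A deviation with an argument \<open>1\<close>
  is \<open>1\<close>, so every nonempty word of a deviation of the elements \<open>1 + letter j\<close> contains all the letters
  (\<open>involves_loop_deviation\<close>). In the total degree only the words that contain each letter exactly once
  are left, and one may calculate modulo words with a repeated letter (relation \<open>\<approx>\<close>).

  Let \<open>D F = rderiv F\<close> and \<open>T F = rderiv2 F\<close> arise from \<open>F\<close> by multiplying the coefficient of a word of weight \<open>n\<close> by \<open>n + 1\<close> and
  by \<open>(n + 1) choose 2\<close>. They are the first two Taylor coefficients of the loop product:
  \<open>F \<odot> (1 + r) \<approx> F + D F * r + T F * r\<^sup>2\<close> if \<open>r\<^sup>3 \<approx> 0\<close>. Expanding both bracketings of \<open>x\<close>, \<open>1 + b\<close>, \<open>1 + c\<close>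
  for letters \<open>b\<close> and \<open>c\<close> shows that the associator \<open>1 + q\<close> satisfies \<open>D x * q \<approx> T x * (b * c - c * b)\<close>
  (\<open>associator_mcong\<close>).

  Modulo repeated letters the loop product of two deviations is additive, so the deviation in \<open>x, x'\<close>
  measures the failure of additivity: up to the constant term it is the value at \<open>x \<odot> x'\<close> minus the
  values at \<open>x\<close> and at \<open>x'\<close>. The subtracted terms miss a letter. Hence the coefficients of the \<open>m\<close>-fold
  deviation at words with all letters are those of the associator of the left-normed product
  \<open>X = ((1 + a\<^sub>1) \<odot> (1 + a\<^sub>2)) \<odot> \<dots> \<odot> (1 + a\<^sub>m)\<close> (\<open>coeff_loop_deviation_foldl\<close>). Modulo repeated letters only
  increasing words occur in \<open>X\<close>, and the coefficients of \<open>D X\<close> and \<open>2 T X\<close> at the increasing word with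
  letter set \<open>B\<close> are \<open>N(B)\<close> and \<open>|B| N(B)\<close>. Solving the equation for \<open>q\<close> by the geometric series in
  \<open>1 - D X\<close> gives \<open>q \<approx> \<Sum>k. (1 - D X)\<^sup>k * T X * (b * c - c * b)\<close>, and expanding the products amounts to
  summing over the ways to cut an arrangement of the letters into nonempty increasing words, that is,
  over ordered set partitions. The factor \<open>2\<close> in front of \<open>T X\<close> is supplied by the antisymmetrization
  in the definition of the bracket.
\<close>

section \<open>Noncommutative formal power series\<close>

typedef ('x, 'k) series = "UNIV :: ('x list \<Rightarrow> 'k) set"
  morphisms coeff Series ..

setup_lifting type_definition_series

lemma coeff_Series [simp]: "coeff (Series f) = f"
  by (simp add: Series_inverse)

lemma series_eqI: "(\<And>w. coeff F w = coeff G w) \<Longrightarrow> F = G"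
  by (simp add: coeff_inject[symmetric] fun_eq_iff)

text \<open>
  Cutting a word in two and then one of the parts again gives the same triples either way. This is
  the associativity of the convolution product.
\<close>

lemma sum_splits_assoc:
  fixes f :: "'x list \<Rightarrow> 'x list \<Rightarrow> 'x list \<Rightarrow> 'b::comm_monoid_add"
  shows "(\<Sum>k\<le>length w. \<Sum>j\<le>length (take k w). f (take j (take k w)) (drop j (take k w)) (drop k w)) =
    (\<Sum>j\<le>length w. \<Sum>k\<le>length (drop j w). f (take j w) (take k (drop j w)) (drop k (drop j w)))"
proof -
  let ?n = "length w"
  have "(\<Sum>k\<le>?n. \<Sum>j\<le>length (take k w). f (take j (take k w)) (drop j (take k w)) (drop k w)) =
      (\<Sum>k\<le>?n. \<Sum>j\<le>k. f (take j w) (take (k - j) (drop j w)) (drop (k - j) (drop j w)))"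
    by (intro sum.cong) (auto simp: min_def drop_take)
  also have "\<dots> = (\<Sum>(j, k)\<in>{(j, k). j + k \<le> ?n}. f (take j w) (take k (drop j w)) (drop k (drop j w)))"
    by (rule sum.triangle_reindex_eq[symmetric])
  also have "{(j, k). j + k \<le> ?n} = Sigma {..?n} (\<lambda>j. {..length (drop j w)})"
    by auto
  finally show ?thesis
    by (simp add: sum.Sigma)
qed

instantiation series :: (type, comm_ring_1) ring_1
begin

lift_definition zero_series :: "('a, 'b) series" is "\<lambda>_. 0" .
lift_definition one_series :: "('a, 'b) series" is "\<lambda>w. if w = [] then 1 else 0" .
lift_definition plus_series :: "('a, 'b) series \<Rightarrow> ('a, 'b) series \<Rightarrow> ('a, 'b) series"
  is "\<lambda>f g w. f w + g w" .
lift_definition minus_series :: "('a, 'b) series \<Rightarrow> ('a, 'b) series \<Rightarrow> ('a, 'b) series"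
  is "\<lambda>f g w. f w - g w" .
lift_definition uminus_series :: "('a, 'b) series \<Rightarrow> ('a, 'b) series"
  is "\<lambda>f w. - f w" .
lift_definition times_series :: "('a, 'b) series \<Rightarrow> ('a, 'b) series \<Rightarrow> ('a, 'b) series"
  is "\<lambda>f g w. \<Sum>k\<le>length w. f (take k w) * g (drop k w)" .

instance
proof
  fix F G H :: "('a, 'b) series"
  show "F * G * H = F * (G * H)"
  proof (transfer, rule ext)
    fix f g h :: "'a list \<Rightarrow> 'b" and w
    show "(\<Sum>k\<le>length w. (\<Sum>j\<le>length (take k w). f (take j (take k w)) * g (drop j (take k w))) * h (drop k w)) =
      (\<Sum>j\<le>length w. f (take j w) * (\<Sum>k\<le>length (drop j w). g (take k (drop j w)) * h (drop k (drop j w))))"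
      using sum_splits_assoc[of "\<lambda>u v t. f u * g v * h t" w]
      by (simp only: sum_distrib_left sum_distrib_right mult.assoc)
  qed
  show "1 * F = F"
  proof (transfer, rule ext)
    fix f :: "'a list \<Rightarrow> 'b" and w
    have "(\<Sum>k\<le>length w. (if take k w = [] then 1 else 0) * f (drop k w)) =
        (\<Sum>k\<in>{0}. (if take k w = [] then 1 else 0) * f (drop k w))"
      by (rule sum.mono_neutral_right) auto
    then show "(\<Sum>k\<le>length w. (if take k w = [] then 1 else 0) * f (drop k w)) = f w"
      by simp
  qed
  show "F * 1 = F"
  proof (transfer, rule ext)
    fix f :: "'a list \<Rightarrow> 'b" and w
    have "(\<Sum>k\<le>length w. f (take k w) * (if drop k w = [] then 1 else 0)) =
        (\<Sum>k\<in>{length w}. f (take k w) * (if drop k w = [] then 1 else 0))"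
      by (rule sum.mono_neutral_right) auto
    then show "(\<Sum>k\<le>length w. f (take k w) * (if drop k w = [] then 1 else 0)) = f w"
      by simp
  qed
  show "(F + G) * H = F * H + G * H" "F * (G + H) = F * G + F * H"
    by (transfer, auto simp: algebra_simps sum.distrib)+
  show "(0::('a, 'b) series) \<noteq> 1"
    by transfer (metis zero_neq_one)
qed (transfer, auto simp: algebra_simps)+

end

lemma coeff_0 [simp]: "coeff 0 w = 0"
  and coeff_1: "coeff 1 w = (if w = [] then 1 else 0)"
  and coeff_plus [simp]: "coeff (F + G) w = coeff F w + coeff G w"
  and coeff_minus [simp]: "coeff (F - G) w = coeff F w - coeff G w"
  and coeff_times: "coeff (F * G) w = (\<Sum>k\<le>length w. coeff F (take k w) * coeff G (drop k w))"
  by (transfer, simp)+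

lemma coeff_of_nat_times [simp]: "coeff (of_nat n * F) w = of_nat n * coeff F w"
  by (induction n) (auto simp: algebra_simps)

lemma coeff_sum [simp]: "coeff (\<Sum>x\<in>A. f x) w = (\<Sum>x\<in>A. coeff (f x) w)"
  by (induction A rule: infinite_finite_induct) auto

definition letter :: "'x \<Rightarrow> ('x, 'k::comm_ring_1) series" where
  "letter j = Series (\<lambda>w. if w = [j] then 1 else 0)"

lemma coeff_letter [simp]: "coeff (letter j) w = (if w = [j] then 1 else 0)"
  by (simp add: letter_def)

text \<open>
  Setting the letters outside \<open>A\<close> to zero is a homomorphism. It serves to show that
  a series has only words over a given alphabet, and that its nonempty words meet a given set of letters.
\<close>

definition restrict :: "'x set \<Rightarrow> ('x, 'k::comm_ring_1) series \<Rightarrow> ('x, 'k) series" where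
  "restrict A F = Series (\<lambda>w. if set w \<subseteq> A then coeff F w else 0)"

lemma coeff_restrict [simp]: "coeff (restrict A F) w = (if set w \<subseteq> A then coeff F w else 0)"
  by (simp add: restrict_def)

lemma set_subset_take_drop: "set w \<subseteq> A \<longleftrightarrow> set (take k w) \<subseteq> A \<and> set (drop k w) \<subseteq> A"
  by (metis append_take_drop_id le_sup_iff set_append)

lemma restrict_1 [simp]: "restrict A 1 = 1"
  by (rule series_eqI) (simp add: coeff_1)

lemma restrict_mult: "restrict A (F * G) = restrict A F * restrict A G"
proof (rule series_eqI)
  fix w
  have "(if set (take k w) \<subseteq> A then s else 0) * (if set (drop k w) \<subseteq> A then t else 0) =
      (if set w \<subseteq> A then s * t else 0)" for k and s t :: 'b
    using set_subset_take_drop[of w A k] by simp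
  then show "coeff (restrict A (F * G)) w = coeff (restrict A F * restrict A G) w"
    unfolding coeff_times coeff_restrict by simp
qed

lemma restrict_power: "restrict A (F ^ n) = restrict A F ^ n"
  by (induction n) (auto simp: restrict_mult)

text \<open>
  Coefficients of products at words of a factor-closed set \<open>L\<close> depend only on coefficients at words of
  \<open>L\<close>. The two cases that matter are the short words, for solving equations by successive
  approximation, and the words without repeated letters.
\<close>

definition factor_closed :: "'x list set \<Rightarrow> bool" where
  "factor_closed L \<longleftrightarrow> (\<forall>u v. u @ v \<in> L \<longrightarrow> u \<in> L \<and> v \<in> L)"

definition agree :: "'x list set \<Rightarrow> ('x, 'k::comm_ring_1) series \<Rightarrow> ('x, 'k) series \<Rightarrow> bool" where
  "agree L F G \<longleftrightarrow> (\<forall>w\<in>L. coeff F w = coeff G w)"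

lemma factor_closedD: "factor_closed L \<Longrightarrow> w \<in> L \<Longrightarrow> take k w \<in> L \<and> drop k w \<in> L"
  unfolding factor_closed_def by (metis append_take_drop_id)

lemma factor_closed_short: "factor_closed {w. length w < n}"
  and factor_closed_distinct: "factor_closed {w. distinct w}"
  by (auto simp: factor_closed_def)

lemma agree_refl [simp]: "agree L F F"
  by (simp add: agree_def)

lemma agree_sym: "agree L F G \<Longrightarrow> agree L G F"
  by (simp add: agree_def)

lemma agree_trans [trans]: "agree L F G \<Longrightarrow> agree L G H \<Longrightarrow> agree L F H"
  by (simp add: agree_def)

lemma agree_add: "agree L F F' \<Longrightarrow> agree L G G' \<Longrightarrow> agree L (F + G) (F' + G')"
  and agree_diff: "agree L F F' \<Longrightarrow> agree L G G' \<Longrightarrow> agree L (F - G) (F' - G')"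
  by (simp_all add: agree_def)

lemma agree_mult:
  "factor_closed L \<Longrightarrow> agree L F F' \<Longrightarrow> agree L G G' \<Longrightarrow> agree L (F * G) (F' * G')"
  unfolding agree_def coeff_times by (simp add: factor_closedD)

lemma agree_power: "factor_closed L \<Longrightarrow> agree L F F' \<Longrightarrow> agree L (F ^ n) (F' ^ n)"
  by (induction n) (auto intro: agree_mult)

section \<open>The loop of formal series and its deviations\<close>

definition weight :: "('x \<Rightarrow> nat) \<Rightarrow> 'x list \<Rightarrow> nat" where
  "weight wt w = sum_list (map wt w)"

lemma weight_simps [simp]: "weight wt [] = 0" "weight wt (j # w) = wt j + weight wt w"
  "weight wt (u @ v) = weight wt u + weight wt v"
  by (auto simp: weight_def)

locale letter_weights =
  fixes wt :: "'x \<Rightarrow> nat"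
begin

text \<open>
  A word of weight \<open>n\<close> in the left factor is multiplied by the power \<open>n + 1\<close> of the right factor, as
  for \<open>\<Sum>m. \<alpha>\<^sub>m \<beta>\<^bsup>m+1\<^esup>\<close> with \<open>\<alpha>\<^sub>m\<close> the part of weight \<open>m\<close>.
\<close>

definition loop_mult :: "('x, 'k::comm_ring_1) series \<Rightarrow> ('x, 'k) series \<Rightarrow> ('x, 'k) series"
    (infixr "\<odot>" 70) where
  "F \<odot> G = Series (\<lambda>w. \<Sum>k\<le>length w.
     coeff F (take k w) * coeff (G ^ (weight wt (take k w) + 1)) (drop k w))"

lemma coeff_loop_mult: "coeff (F \<odot> G) w = (\<Sum>k\<le>length w.
     coeff F (take k w) * coeff (G ^ (weight wt (take k w) + 1)) (drop k w))"
  by (simp add: loop_mult_def)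

lemma coeff_loop_mult_Nil: "coeff (F \<odot> G) [] = coeff F [] * coeff G []"
  by (simp add: coeff_loop_mult)

lemma loop_mult_split:
  assumes "coeff F [] = 1"
  shows "coeff (F \<odot> G) w = coeff G w + (\<Sum>k\<in>{1..length w}.
     coeff F (take k w) * coeff (G ^ (weight wt (take k w) + 1)) (drop k w))"
proof -
  have "{..length w} = insert 0 {1..length w}" by auto
  then show ?thesis
    by (simp add: coeff_loop_mult assms)
qed

lemma loop_mult_1_left [simp]: "1 \<odot> F = F"
  by (rule series_eqI) (auto simp: loop_mult_split coeff_1 intro!: sum.neutral)

lemma loop_mult_1_right [simp]: "F \<odot> 1 = F"
proof (rule series_eqI)
  fix w
  have "coeff (F \<odot> 1) w = coeff (F * 1) w"
    unfolding coeff_loop_mult coeff_times by simp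
  then show "coeff (F \<odot> 1) w = coeff F w" by simp
qed

lemma agree_loop_mult:
  assumes L: "factor_closed L" and F: "agree L F F'" and G: "agree L G G'"
  shows "agree L (F \<odot> G) (F' \<odot> G')"
  unfolding agree_def
proof
  fix w assume "w \<in> L"
  then have "coeff F (take k w) = coeff F' (take k w)"
      "coeff (G ^ l) (drop k w) = coeff (G' ^ l) (drop k w)" for k l
    using factor_closedD[OF L] F agree_power[OF L G] by (auto simp: agree_def)
  then show "coeff (F \<odot> G) w = coeff (F' \<odot> G') w"
    unfolding coeff_loop_mult by (simp only:)
qed

lemma restrict_loop_mult: "restrict A (F \<odot> G) = restrict A F \<odot> restrict A G"
proof (rule series_eqI)
  fix w
  have "(if set (take k w) \<subseteq> A then s else 0) * (if set (drop k w) \<subseteq> A then t else 0) =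
      (if set w \<subseteq> A then s * t else 0)" for k and s t :: 'a
    using set_subset_take_drop[of w A k] by simp
  then show "coeff (restrict A (F \<odot> G)) w = coeff (restrict A F \<odot> restrict A G) w"
    unfolding coeff_loop_mult coeff_restrict restrict_power[symmetric] by simp
qed

text \<open>
  A coefficient of \<open>q\<close> enters \<open>x \<odot> q - q\<close> only after a nonempty word of \<open>x\<close>, so one more length is
  determined. This contraction property gives both existence and uniqueness of left quotients.
\<close>

lemma agree_loop_mult_diff:
  assumes x: "coeff x [] = 1" and q: "agree {w. length w < n} q q'"
  shows "agree {w. length w < Suc n} (x \<odot> q - q) (x \<odot> q' - q')"
  unfolding agree_def
proof
  fix w :: "'x list" assume w: "w \<in> {w. length w < Suc n}"
  have "coeff (q ^ l) (drop k w) = coeff (q' ^ l) (drop k w)" if "k \<in> {1..length w}" for k l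
    using agree_power[OF factor_closed_short q, of l] that w by (auto simp: agree_def)
  then show "coeff (x \<odot> q - q) w = coeff (x \<odot> q' - q') w"
    by (simp add: loop_mult_split[OF x] del: power_Suc)
qed

lemma loop_left_cancel:
  assumes x: "coeff x [] = 1" and eq: "x \<odot> q = x \<odot> q'"
  shows "q = q'"
proof -
  have "agree {w. length w < n} q q'" for n
  proof (induction n)
    case (Suc n)
    from agree_diff[OF agree_refl agree_loop_mult_diff[OF x Suc], of "x \<odot> q"] eq
    show ?case by simp
  qed (simp add: agree_def)
  then show ?thesis
    by (intro series_eqI) (auto simp: agree_def)
qed

lemma ex_loop_left_division:
  fixes y :: "('x, 'k::comm_ring_1) series"
  assumes x: "coeff x [] = 1"
  shows "\<exists>q. x \<odot> q = y"
proof -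
  \<comment> \<open>The fixed points of \<open>step\<close> are the solutions; the \<open>n\<close>-th iterate is exact on words shorter than \<open>n\<close>.\<close>
  define step where "step = (\<lambda>q. y - (x \<odot> q - q))"
  define it where "it n = (step ^^ n) 0" for n
  have it_Suc: "it (Suc n) = step (it n)" for n by (simp add: it_def)
  have step: "agree {w. length w < Suc n} (step q) (step q')"
    if "agree {w. length w < n} q q'" for n q q'
    unfolding step_def by (intro agree_diff agree_refl agree_loop_mult_diff x that)
  have stable1: "agree {w. length w < n} (it n) (it (Suc n))" for n
    by (induction n) (auto simp: it_Suc intro: step, simp add: agree_def)
  have stable: "agree {w. length w < n} (it n) (it (n + d))" for n d
  proof (induction d)
    case (Suc d)
    then show ?case using stable1[of "n + d"] by (auto simp: agree_def)
  qed simp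
  define q where "q = Series (\<lambda>w. coeff (it (Suc (length w))) w)"
  have q: "agree {w. length w < n} q (it n)" for n
    unfolding agree_def
  proof
    fix w :: "'x list" assume "w \<in> {w. length w < n}"
    then show "coeff q w = coeff (it n) w"
      using stable[of "Suc (length w)" "n - Suc (length w)"] by (auto simp: q_def agree_def)
  qed
  have "agree {w. length w < Suc n} q (step q)" for n
    using agree_trans[OF q[of "Suc n"]] agree_sym[OF step[OF q[of n]]] by (simp add: it_Suc)
  then have "q = step q"
    by (intro series_eqI) (auto simp: agree_def)
  then have "x \<odot> q = y"
    by (simp add: step_def algebra_simps)
  then show ?thesis ..
qed

definition loop_ldiv :: "('x, 'k::comm_ring_1) series \<Rightarrow> ('x, 'k) series \<Rightarrow> ('x, 'k) series" where
  "loop_ldiv x y = (SOME q. x \<odot> q = y)"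

lemma loop_mult_ldiv: "coeff x [] = 1 \<Longrightarrow> x \<odot> loop_ldiv x y = y"
  unfolding loop_ldiv_def by (rule someI_ex[OF ex_loop_left_division])

lemma loop_ldiv_eqI: "coeff x [] = 1 \<Longrightarrow> x \<odot> q = y \<Longrightarrow> loop_ldiv x y = q"
  using loop_left_cancel loop_mult_ldiv by metis

lemma coeff_loop_ldiv_Nil: "coeff x [] = 1 \<Longrightarrow> coeff (loop_ldiv x y) [] = coeff y []"
  using arg_cong[OF loop_mult_ldiv, of x "\<lambda>q. coeff q []" y] by (simp add: coeff_loop_mult_Nil)

lemma loop_ldiv_self: "coeff x [] = 1 \<Longrightarrow> loop_ldiv x x = 1"
  by (rule loop_ldiv_eqI) auto

lemma restrict_loop_ldiv:
  "coeff x [] = 1 \<Longrightarrow> restrict A (loop_ldiv x y) = loop_ldiv (restrict A x) (restrict A y)"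
  by (rule loop_ldiv_eqI[symmetric]) (auto simp: restrict_loop_mult[symmetric] loop_mult_ldiv)

text \<open>
  The deviation in the arguments \<open>x # xs @ [y, z]\<close> whose indices are all \<open>1\<close>.
\<close>

fun loop_deviation :: "('x, 'k::comm_ring_1) series \<Rightarrow> ('x, 'k) series list \<Rightarrow>
    ('x, 'k) series \<Rightarrow> ('x, 'k) series \<Rightarrow> ('x, 'k) series" where
  "loop_deviation x [] y z = loop_ldiv (x \<odot> (y \<odot> z)) ((x \<odot> y) \<odot> z)"
| "loop_deviation x (x' # xs) y z =
     loop_ldiv (loop_deviation x xs y z \<odot> loop_deviation x' xs y z) (loop_deviation (x \<odot> x') xs y z)"

lemma coeff_loop_deviation_Nil:
  assumes "\<forall>u\<in>set (x # xs) \<union> {y, z}. coeff u [] = 1"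
  shows "coeff (loop_deviation x xs y z) [] = 1"
  using assms
  by (induction xs arbitrary: x) (simp_all add: coeff_loop_ldiv_Nil coeff_loop_mult_Nil)

lemma restrict_loop_deviation:
  assumes "\<forall>u\<in>set (x # xs) \<union> {y, z}. coeff u [] = 1"
  shows "restrict A (loop_deviation x xs y z) =
    loop_deviation (restrict A x) (map (restrict A) xs) (restrict A y) (restrict A z)"
  using assms
  by (induction xs arbitrary: x)
     (simp_all add: restrict_loop_ldiv restrict_loop_mult coeff_loop_mult_Nil coeff_loop_deviation_Nil)

text \<open>
  The associator with an argument \<open>1\<close> is a quotient of equal elements. In a further deviation, an
  argument \<open>1\<close> other than the first two makes all three terms \<open>1\<close>; if one of the first two is \<open>1\<close>, then
  its factor is \<open>1\<close> and the other factor equals the dividend.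
\<close>

lemma loop_deviation_unit:
  assumes "\<forall>u\<in>set (x # xs) \<union> {y, z}. coeff u [] = 1" "1 \<in> set (x # xs) \<union> {y, z}"
  shows "loop_deviation x xs y z = 1"
  using assms
proof (induction xs arbitrary: x)
  case Nil
  then show ?case by (auto simp: loop_ldiv_self coeff_loop_mult_Nil)
next
  case (Cons x' xs)
  have c: "coeff (loop_deviation u xs y z) [] = 1" if "u \<in> {x, x', x \<odot> x'}" for u
    using that Cons.prems by (intro coeff_loop_deviation_Nil) (auto simp: coeff_loop_mult_Nil)
  show ?case
  proof (cases "1 \<in> set xs \<union> {y, z}")
    case True
    then have "loop_deviation u xs y z = 1" if "u \<in> {x, x', x \<odot> x'}" for u
      using that Cons.prems by (intro Cons.IH) (auto simp: coeff_loop_mult_Nil)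
    then show ?thesis by (simp add: loop_ldiv_self coeff_1)
  next
    case False
    then consider "x = 1" | "x' = 1" using Cons.prems by auto
    then show ?thesis
    proof cases
      case 1
      then have "loop_deviation x xs y z = 1" using Cons.prems by (intro Cons.IH) auto
      then show ?thesis using c 1 by (simp add: loop_ldiv_self)
    next
      case 2
      then have "loop_deviation x' xs y z = 1" using Cons.prems by (intro Cons.IH) auto
      then show ?thesis using c 2 by (simp add: loop_ldiv_self)
    qed
  qed
qed

end

section \<open>Calculus modulo repeated letters\<close>

lemma coeff_times_letter:
  "coeff (F * letter j) w = (if w \<noteq> [] \<and> last w = j then coeff F (butlast w) else 0)"
proof (cases w rule: rev_cases)
  case Nil
  then show ?thesis by (simp add: coeff_times)
next
  case (snoc u l)
  have "drop k (u @ [l]) = [j] \<longleftrightarrow> k = length u \<and> l = j" if "k \<le> Suc (length u)" for k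
  proof -
    have "k < length u \<or> k = length u \<or> k = Suc (length u)" using that by linarith
    then consider "k < length u" | "k = length u" | "k = Suc (length u)" by blast
    then show ?thesis
    proof cases
      case 1
      then have "length (drop k (u @ [l])) > 1" by simp
      then show ?thesis using 1 by (metis length_Cons less_irrefl list.size(3) One_nat_def nat_neq_iff)
    qed auto
  qed
  then have "coeff (F * letter j) w = (\<Sum>k\<le>Suc (length u). if k = length u then
      (if l = j then coeff F u else 0) else 0)"
    unfolding coeff_times snoc by (intro sum.cong) auto
  then show ?thesis
    by (simp add: snoc)
qed

text \<open>
  In particular the constant term is \<open>0\<close>, since the empty word has no letters.
\<close>

definition involves :: "'x set \<Rightarrow> ('x, 'k::comm_ring_1) series \<Rightarrow> bool" where
  "involves A F \<longleftrightarrow> (\<forall>w. coeff F w \<noteq> 0 \<longrightarrow> set w \<inter> A \<noteq> {})"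

lemma involves_mult_left: "involves A F \<Longrightarrow> involves A (F * G)"
  and involves_mult_right: "involves A G \<Longrightarrow> involves A (F * G)"
  unfolding involves_def coeff_times
  by (intro allI impI, elim sum.not_neutral_contains_not_neutral,
      metis set_take_subset set_drop_subset disjoint_iff subsetD mult_zero_left mult_zero_right)+

lemma involves_add: "involves A F \<Longrightarrow> involves A G \<Longrightarrow> involves A (F + G)"
  unfolding involves_def by (metis coeff_plus add.right_neutral)

lemma involves_letter: "involves {j} (letter j)"
  by (simp add: involves_def)

abbreviation mcong :: "('x, 'k::comm_ring_1) series \<Rightarrow> ('x, 'k) series \<Rightarrow> bool" (infix "\<approx>" 50) where
  "F \<approx> G \<equiv> agree {w. distinct w} F G"

lemma mcong_mult: "F \<approx> F' \<Longrightarrow> G \<approx> G' \<Longrightarrow> F * G \<approx> F' * G'"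
  by (rule agree_mult[OF factor_closed_distinct])

text \<open>
  The letter \<open>j\<close> occurs in both factors, hence twice in each word of the product.
\<close>

lemma involves_mult_mcong_0:
  assumes "involves {j} F" "involves {j} G"
  shows "F * G \<approx> 0"
  unfolding agree_def
proof
  fix w :: "'a list" assume "w \<in> {w. distinct w}"
  then have "set (take k w) \<inter> set (drop k w) = {}" for k
    using set_take_disj_set_drop_if_distinct by blast
  then have "coeff F (take k w) = 0 \<or> coeff G (drop k w) = 0" for k
    using assms unfolding involves_def by blast
  then show "coeff (F * G) w = coeff 0 w"
    unfolding coeff_times coeff_0 by (intro sum.neutral ballI) (metis mult_zero_left mult_zero_right)
qed

lemma mcong_one_plus_power:
  assumes "r * r * r \<approx> 0"
  shows "(1 + r) ^ n \<approx> 1 + of_nat n * r + of_nat (n choose 2) * (r * r)"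
proof (induction n)
  case (Suc n)
  let ?c = "of_nat n * r + of_nat (n choose 2) * (r * r)"
  have "(1 + r) ^ Suc n = (1 + r) ^ n * (1 + r)"
    by (rule power_Suc2)
  also have "\<dots> \<approx> (1 + of_nat n * r + of_nat (n choose 2) * (r * r)) * (1 + r)"
    by (intro mcong_mult Suc agree_refl)
  also have "\<dots> = 1 + of_nat (Suc n) * r + of_nat (Suc n choose 2) * (r * r)
      + of_nat (n choose 2) * (r * r * r)"
    by (simp add: algebra_simps numeral_2_eq_2)
  also have "\<dots> \<approx> 1 + of_nat (Suc n) * r + of_nat (Suc n choose 2) * (r * r) + of_nat (n choose 2) * 0"
    by (intro agree_add mcong_mult agree_refl assms)
  finally show ?case by simp
qed (simp add: numeral_2_eq_2)

context letter_weights
begin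

text \<open>
  The first and second Taylor coefficients of the left translation \<open>G \<mapsto> F \<odot> G\<close> at \<open>G = 1\<close>, which come
  from the binomial expansion of the powers \<open>(1 + r) ^ (n + 1)\<close>.
\<close>

definition rderiv :: "('x, 'k::comm_ring_1) series \<Rightarrow> ('x, 'k) series" where
  "rderiv F = Series (\<lambda>w. of_nat (weight wt w + 1) * coeff F w)"

definition rderiv2 :: "('x, 'k::comm_ring_1) series \<Rightarrow> ('x, 'k) series" where
  "rderiv2 F = Series (\<lambda>w. of_nat ((weight wt w + 1) choose 2) * coeff F w)"

lemma coeff_rderiv: "coeff (rderiv F) w = of_nat (weight wt w + 1) * coeff F w"
  and coeff_rderiv2: "coeff (rderiv2 F) w = of_nat ((weight wt w + 1) choose 2) * coeff F w"
  by (simp_all add: rderiv_def rderiv2_def)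

lemma rderiv_add: "rderiv (F + G) = rderiv F + rderiv G"
  and rderiv_1 [simp]: "rderiv 1 = 1"
  by (intro series_eqI; simp add: coeff_rderiv coeff_1 algebra_simps)+

lemma rderiv_letter: "rderiv (letter j) = of_nat (wt j + 1) * letter j"
  by (intro series_eqI) (simp add: coeff_rderiv del: of_nat_Suc of_nat_add)

lemma rderiv_times_letter: "rderiv (F * letter j) = rderiv F * letter j + of_nat (wt j) * (F * letter j)"
proof (rule series_eqI)
  fix w
  show "coeff (rderiv (F * letter j)) w = coeff (rderiv F * letter j + of_nat (wt j) * (F * letter j)) w"
    by (cases w rule: rev_cases) (auto simp: coeff_rderiv coeff_times_letter algebra_simps)
qed

text \<open>
  This is \<open>(n + 1)\<^sup>2 = (n + 1) + 2 * ((n + 1) choose 2)\<close> for the weight \<open>n\<close> of a word. It is what makes the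
  two bracketings of three elements differ.
\<close>

lemma rderiv_rderiv:
  fixes F :: "('x, 'k::comm_ring_1) series"
  shows "rderiv (rderiv F) = rderiv F + of_nat 2 * rderiv2 F"
proof (rule series_eqI)
  fix w
  let ?n = "weight wt w"
  have "(?n + 1) * (?n + 1) = (?n + 1) + 2 * ((?n + 1) choose 2)"
    by (simp add: choose_two)
  then have "(of_nat (?n + 1) * of_nat (?n + 1) :: 'k) = of_nat (?n + 1) + of_nat 2 * of_nat ((?n + 1) choose 2)"
    by (metis of_nat_add of_nat_mult)
  then show "coeff (rderiv (rderiv F)) w = coeff (rderiv F + of_nat 2 * rderiv2 F) w"
    unfolding coeff_rderiv coeff_plus coeff_of_nat_times coeff_rderiv2
    by (simp only: mult.assoc[symmetric] distrib_right[symmetric])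
qed

lemma rderiv_mcong: "F \<approx> G \<Longrightarrow> rderiv F \<approx> rderiv G"
  by (simp add: agree_def coeff_rderiv)

lemma involves_rderiv: "involves A F \<Longrightarrow> involves A (rderiv F)"
  unfolding involves_def coeff_rderiv by (metis mult_zero_right)

lemma loop_mult_mcong: "F \<approx> F' \<Longrightarrow> G \<approx> G' \<Longrightarrow> F \<odot> G \<approx> F' \<odot> G'"
  by (rule agree_loop_mult[OF factor_closed_distinct])

lemma loop_mult_one_plus_quadratic:
  assumes "r * r * r \<approx> 0"
  shows "F \<odot> (1 + r) \<approx> F + rderiv F * r + rderiv2 F * (r * r)"
  unfolding agree_def
proof
  fix w :: "'x list" assume "w \<in> {w. distinct w}"
  then have "coeff ((1 + r) ^ n) (drop k w) =
      coeff (1 + of_nat n * r + of_nat (n choose 2) * (r * r)) (drop k w)" for n k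
    using mcong_one_plus_power[OF assms, of n] by (auto simp: agree_def)
  then have "coeff (F \<odot> (1 + r)) w = (\<Sum>k\<le>length w. coeff F (take k w) * coeff 1 (drop k w)
      + coeff (rderiv F) (take k w) * coeff r (drop k w)
      + coeff (rderiv2 F) (take k w) * coeff (r * r) (drop k w))"
    unfolding coeff_loop_mult coeff_rderiv coeff_rderiv2
    by (intro sum.cong) (simp_all only: coeff_plus coeff_of_nat_times algebra_simps)
  also have "\<dots> = coeff (F * 1 + rderiv F * r + rderiv2 F * (r * r)) w"
    unfolding coeff_plus coeff_times[of F] coeff_times[of "rderiv F"] coeff_times[of "rderiv2 F"]
    by (simp only: sum.distrib)
  finally show "coeff (F \<odot> (1 + r)) w = coeff (F + rderiv F * r + rderiv2 F * (r * r)) w"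
    by simp
qed

lemma loop_mult_one_plus_linear:
  assumes "r * r \<approx> 0"
  shows "F \<odot> (1 + r) \<approx> F + rderiv F * r"
proof -
  have "r * r * r \<approx> 0 * r"
    by (intro mcong_mult assms agree_refl)
  then have "F \<odot> (1 + r) \<approx> F + rderiv F * r + rderiv2 F * (r * r)"
    by (intro loop_mult_one_plus_quadratic) simp
  also have "\<dots> \<approx> F + rderiv F * r + rderiv2 F * 0"
    by (intro agree_add mcong_mult assms agree_refl)
  finally show ?thesis by simp
qed

lemma loop_mult_letter: "F \<odot> (1 + letter j) \<approx> F + rderiv F * letter j"
  by (intro loop_mult_one_plus_linear involves_mult_mcong_0[of j] involves_letter)

text \<open>
  Setting the letters of \<open>A\<close> to zero turns one argument, and hence the deviation, into \<open>1\<close>.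
\<close>

lemma involves_loop_deviation:
  assumes "\<forall>u\<in>set (x # xs) \<union> {y, z}. coeff u [] = 1"
    and "\<exists>u\<in>set (x # xs) \<union> {y, z}. restrict (- A) u = 1"
  shows "involves A (loop_deviation x xs y z - 1)"
  unfolding involves_def
proof (intro allI impI notI)
  fix w assume w: "coeff (loop_deviation x xs y z - 1) w \<noteq> 0" "set w \<inter> A = {}"
  have "restrict (- A) (loop_deviation x xs y z) = 1"
    unfolding restrict_loop_deviation[OF assms(1)] using assms
    by (intro loop_deviation_unit) (auto simp: image_iff)
  then have "coeff (loop_deviation x xs y z) w = coeff 1 w"
    using w(2) coeff_restrict[of "- A" "loop_deviation x xs y z" w] by auto
  with w(1) show False by simp
qed

lemma restrict_one_plus_letter:
  "restrict A (1 + letter j) = (if j \<in> A then 1 + letter j else 1)"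
  by (auto intro!: series_eqI simp: coeff_1)

text \<open>
  Both \<open>f = x \<odot> (y \<odot> z)\<close> and \<open>g = (x \<odot> y) \<odot> z\<close> are expanded by the Taylor formula. As \<open>q\<close> contains both
  letters, \<open>q * q \<approx> 0\<close> and \<open>rderiv f * q \<approx> rderiv x * q\<close>, so that \<open>g = f \<odot> (1 + q)\<close> reads
  \<open>g - f \<approx> rderiv x * q\<close>. In \<open>g - f\<close> the terms with the factor \<open>rderiv x\<close> cancel, \<open>g\<close> contributes \<open>2 * rderiv2 x * b * c\<close>
  through \<open>rderiv_rderiv\<close>, and \<open>f\<close> contributes \<open>rderiv2 x * (b * c + c * b)\<close> through the square of
  \<open>y \<odot> z - 1\<close>.
\<close>

lemma associator_mcong:
  fixes x :: "('x, 'k::comm_ring_1) series"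
  assumes x: "coeff x [] = 1" and "\<beta> \<noteq> \<gamma>"
  defines "b \<equiv> letter \<beta>" and "c \<equiv> letter \<gamma>"
  shows "rderiv x * (loop_deviation x [] (1 + b) (1 + c) - 1) \<approx> rderiv2 x * (b * c - c * b)"
proof -
  define q where "q = loop_deviation x [] (1 + b) (1 + c) - 1"
  define f where "f = x \<odot> ((1 + b) \<odot> (1 + c))"
  define g where "g = (x \<odot> (1 + b)) \<odot> (1 + c)"
  have const: "\<forall>u\<in>set [x] \<union> {1 + b, 1 + c}. coeff u [] = 1"
    using x by (simp add: b_def c_def coeff_1)
  have qb: "involves {\<beta>} q" and qc: "involves {\<gamma>} q"
    unfolding q_def using const
    by (auto intro!: involves_loop_deviation simp: b_def c_def restrict_one_plus_letter
        simp del: loop_deviation.simps)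
  have ib: "involves {\<beta>} b" and ic: "involves {\<gamma>} c"
    unfolding b_def c_def by (rule involves_letter)+
  have qq: "q * q \<approx> 0" by (rule involves_mult_mcong_0[OF qb qb])

  \<comment> \<open>\<open>y \<odot> z \<approx> 1 + (b + s)\<close>, where \<open>b\<close> and \<open>s\<close> square to zero because each contains a fixed letter.\<close>
  define s where "s = c + of_nat (wt \<beta> + 1) * (b * c)"
  have isg: "involves {\<gamma>} s"
    unfolding s_def by (intro involves_add involves_mult_right ic)
  have commute: "t * (of_nat n * u) = of_nat n * (t * u)" for n and t u :: "('x, 'k) series"
    by (simp only: mult.assoc[symmetric] mult_of_nat_commute[of n t])
  have yz: "(1 + b) \<odot> (1 + c) \<approx> 1 + (b + s)"
  proof -
    have "(1 + b) \<odot> (1 + c) \<approx> (1 + b) + rderiv (1 + b) * c"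
      unfolding c_def by (rule loop_mult_letter)
    also have "\<dots> = 1 + (b + s)"
      by (simp add: s_def rderiv_add b_def rderiv_letter algebra_simps)
    finally show ?thesis .
  qed
  have rr: "(b + s) * (b + s) \<approx> b * c + c * b"
  proof -
    have "b * (b * c) \<approx> 0" "b * (c * b) \<approx> 0"
      by (rule involves_mult_mcong_0[OF ib], rule involves_mult_left involves_mult_right, rule ib)+
    then have "b * b + (b * c + of_nat (wt \<beta> + 1) * (b * (b * c)))
        + (c * b + of_nat (wt \<beta> + 1) * (b * (c * b))) + s * s
        \<approx> 0 + (b * c + of_nat (wt \<beta> + 1) * 0) + (c * b + of_nat (wt \<beta> + 1) * 0) + 0"
      by (intro agree_add mcong_mult agree_refl involves_mult_mcong_0[OF ib ib]
            involves_mult_mcong_0[OF isg isg])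
    moreover have "b * s = b * c + of_nat (wt \<beta> + 1) * (b * (b * c))"
      unfolding s_def distrib_left commute ..
    moreover have "s * b = c * b + of_nat (wt \<beta> + 1) * (b * (c * b))"
      unfolding s_def distrib_right mult.assoc ..
    moreover have "(b + s) * (b + s) = b * b + b * s + s * b + s * s"
      by (simp add: distrib_left distrib_right)
    ultimately show ?thesis by simp
  qed
  have rrr: "(b + s) * (b + s) * (b + s) \<approx> 0"
  proof -
    have "(b + s) * (b + s) * (b + s) \<approx> (b * c + c * b) * (b + s)"
      by (intro mcong_mult rr agree_refl)
    also have "\<dots> = (b * c + c * b) * b + (b * c + c * b) * s"
      by (rule distrib_left)
    also have "\<dots> \<approx> 0 + 0"
      by (intro agree_add involves_mult_mcong_0[OF _ ib] involves_mult_mcong_0[OF _ isg])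
         (rule involves_add, ((rule involves_mult_left involves_mult_right, rule ib ic)+))+
    finally show ?thesis by simp
  qed
  have f: "f \<approx> x + rderiv x * (b + s) + rderiv2 x * (b * c + c * b)"
  proof -
    have "f \<approx> x \<odot> (1 + (b + s))"
      unfolding f_def by (intro loop_mult_mcong yz agree_refl)
    also have "\<dots> \<approx> x + rderiv x * (b + s) + rderiv2 x * ((b + s) * (b + s))"
      by (rule loop_mult_one_plus_quadratic[OF rrr])
    also have "\<dots> \<approx> x + rderiv x * (b + s) + rderiv2 x * (b * c + c * b)"
      by (intro agree_add mcong_mult rr agree_refl)
    finally show ?thesis .
  qed
  have g: "g \<approx> x + rderiv x * b + rderiv (x + rderiv x * b) * c"
  proof -
    have "g \<approx> (x + rderiv x * b) \<odot> (1 + c)"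
      unfolding g_def b_def by (intro loop_mult_mcong loop_mult_letter agree_refl)
    also have "\<dots> \<approx> x + rderiv x * b + rderiv (x + rderiv x * b) * c"
      unfolding c_def by (rule loop_mult_letter)
    finally show ?thesis .
  qed
  have "g = f \<odot> (1 + q)"
    unfolding f_def g_def q_def using const by (simp add: loop_mult_ldiv coeff_loop_mult_Nil)
  then have "g \<approx> f + rderiv f * q"
    using loop_mult_one_plus_linear[OF qq] by simp
  moreover have "rderiv f * q \<approx> rderiv x * q"
  proof -
    have "rderiv f * q \<approx> rderiv (x + rderiv x * (b + s) + rderiv2 x * (b * c + c * b)) * q"
      by (intro mcong_mult rderiv_mcong f agree_refl)
    also have "\<dots> = rderiv x * q + rderiv (rderiv x * b) * q + rderiv (rderiv x * s) * q
        + rderiv (rderiv2 x * (b * c + c * b)) * q"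
      by (simp add: rderiv_add distrib_left distrib_right)
    also have "\<dots> \<approx> rderiv x * q + 0 + 0 + 0"
    proof (intro agree_add agree_refl)
      show "rderiv (rderiv x * b) * q \<approx> 0" "rderiv (rderiv2 x * (b * c + c * b)) * q \<approx> 0"
        by (rule involves_mult_mcong_0[OF involves_rderiv[OF involves_mult_right[OF ib]] qb])
           (rule involves_mult_mcong_0[OF involves_rderiv[OF involves_mult_right[OF
                involves_add[OF involves_mult_left[OF ib] involves_mult_right[OF ib]]]] qb])
      show "rderiv (rderiv x * s) * q \<approx> 0"
        by (intro involves_mult_mcong_0[OF _ qc] involves_rderiv involves_mult_right isg)
    qed
    finally show ?thesis by simp
  qed
  ultimately have "g - f \<approx> rderiv x * q"
    by (simp add: agree_def)
  then have "rderiv x * q \<approx> g - f" by (rule agree_sym)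
  also have "\<dots> \<approx> (x + rderiv x * b + rderiv (x + rderiv x * b) * c)
      - (x + rderiv x * (b + s) + rderiv2 x * (b * c + c * b))"
    by (intro agree_diff f g)
  also have "\<dots> = rderiv2 x * (b * c - c * b)"
  proof -
    have "rderiv (rderiv x * b) * c = of_nat (wt \<beta> + 1) * (rderiv x * b * c) + of_nat 2 * (rderiv2 x * b * c)"
      unfolding b_def rderiv_times_letter rderiv_rderiv
      by (simp add: distrib_left distrib_right mult.assoc)
    moreover have "rderiv x * s = rderiv x * c + of_nat (wt \<beta> + 1) * (rderiv x * b * c)"
      unfolding s_def distrib_left commute mult.assoc ..
    ultimately show ?thesis
      by (simp add: rderiv_add distrib_left distrib_right right_diff_distrib mult.assoc mult_2)
  qed
  finally show ?thesis unfolding q_def .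
qed

text \<open>
  All deviations minus \<open>1\<close> contain the letter \<open>\<beta>\<close> of \<open>y\<close>, so their products vanish and the loop product
  of deviations becomes addition.
\<close>

lemma loop_deviation_Cons_mcong:
  assumes const: "\<forall>u\<in>set (x # x' # xs) \<union> {y, z}. coeff u [] = 1"
    and y: "restrict (- {\<beta>}) y = 1"
  shows "loop_deviation x (x' # xs) y z - 1 \<approx>
    (loop_deviation (x \<odot> x') xs y z - 1) - (loop_deviation x xs y z - 1) - (loop_deviation x' xs y z - 1)"
proof -
  define u where "u = loop_deviation x xs y z - 1"
  define v where "v = loop_deviation x' xs y z - 1"
  define t where "t = loop_deviation (x \<odot> x') xs y z - 1"
  define q where "q = loop_deviation x (x' # xs) y z - 1"
  have iu: "involves {\<beta>} u" and iv: "involves {\<beta>} v" and iq: "involves {\<beta>} q"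
    unfolding u_def v_def q_def using const y by (auto intro!: involves_loop_deviation simp del: loop_deviation.simps)
  have "coeff (1 + u) [] = 1" "coeff (1 + v) [] = 1"
    unfolding u_def v_def using const by (simp_all add: coeff_loop_deviation_Nil)
  then have "1 + t = ((1 + u) \<odot> (1 + v)) \<odot> (1 + q)"
    unfolding t_def u_def v_def q_def by (simp add: loop_mult_ldiv coeff_loop_mult_Nil)
  also have "\<dots> \<approx> (1 + u + v) \<odot> (1 + q)"
  proof (intro loop_mult_mcong agree_refl)
    have "(1 + u) \<odot> (1 + v) \<approx> 1 + u + rderiv (1 + u) * v"
      by (intro loop_mult_one_plus_linear involves_mult_mcong_0[OF iv iv])
    also have "\<dots> = 1 + u + v + rderiv u * v"
      by (simp add: rderiv_add distrib_right)
    also have "\<dots> \<approx> 1 + u + v + 0"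
      by (intro agree_add agree_refl involves_mult_mcong_0[OF involves_rderiv iv] iu)
    finally show "(1 + u) \<odot> (1 + v) \<approx> 1 + u + v" by simp
  qed
  also have "\<dots> \<approx> 1 + u + v + rderiv (1 + u + v) * q"
    by (intro loop_mult_one_plus_linear involves_mult_mcong_0[OF iq iq])
  also have "\<dots> = 1 + u + v + q + rderiv (u + v) * q"
    by (simp add: rderiv_add distrib_right)
  also have "\<dots> \<approx> 1 + u + v + q + 0"
    by (intro agree_add agree_refl involves_mult_mcong_0[OF involves_rderiv iq] involves_add iu iv)
  finally have "1 + t \<approx> 1 + u + v + q" by simp
  then have "q \<approx> t - u - v"
    by (simp add: agree_def algebra_simps)
  then show ?thesis
    by (simp add: q_def t_def u_def v_def)
qed

lemma coeff_loop_deviation_outside: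
  assumes "\<forall>u\<in>set (x # xs) \<union> {y, z}. coeff u [] = 1 \<and> restrict A u = u" and "\<not> set w \<subseteq> A"
  shows "coeff (loop_deviation x xs y z) w = 0"
proof -
  have "restrict A (loop_deviation x xs y z) = loop_deviation x xs y z"
    using assms(1) by (subst restrict_loop_deviation) (auto simp: map_idI)
  then show ?thesis
    using assms(2) coeff_restrict[of A "loop_deviation x xs y z" w] by simp
qed

text \<open>
  Of the three terms in \<open>loop_deviation_Cons_mcong\<close> only the one with the loop product contributes: the
  term in \<open>x\<close> alone lacks the first letter \<open>j\<close> of the list, and the term in \<open>1 + letter j\<close> alone lacks all
  letters of \<open>A\<close>, whereas \<open>w\<close> contains both kinds.
\<close>

lemma coeff_loop_deviation_foldl:
  fixes x :: "('x, 'k::comm_ring_1) series"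
  defines "e \<equiv> \<lambda>j::'x. 1 + letter j :: ('x, 'k) series"
  assumes "coeff x [] = 1" "restrict A x = x" "distinct (js @ [\<beta>, \<gamma>])"
    and "A \<inter> set (js @ [\<beta>, \<gamma>]) = {}" "distinct w" "set js \<subseteq> set w" "set w \<inter> A \<noteq> {}"
  shows "coeff (loop_deviation x (map e js) (e \<beta>) (e \<gamma>)) w =
    coeff (loop_deviation (foldl (\<odot>) x (map e js)) [] (e \<beta>) (e \<gamma>)) w"
  using assms(2-)
proof (induction js arbitrary: x A)
  case (Cons j js)
  have e0: "coeff (e k) [] = 1" for k by (simp add: e_def coeff_1)
  have er: "restrict B (e k) = e k" if "k \<in> B" for k B
    using that by (simp add: e_def restrict_one_plus_letter)
  have er1: "restrict B (e k) = 1" if "k \<notin> B" for k B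
    using that by (simp add: e_def restrict_one_plus_letter)
  have rx: "restrict B x = x" if "A \<subseteq> B" for B
    using that \<open>restrict A x = x\<close> by (metis (no_types, lifting) coeff_restrict series_eqI subset_trans)
  have w: "w \<noteq> []" using Cons.prems by auto
  have "loop_deviation x (e j # map e js) (e \<beta>) (e \<gamma>) - 1 \<approx>
      (loop_deviation (x \<odot> e j) (map e js) (e \<beta>) (e \<gamma>) - 1)
      - (loop_deviation x (map e js) (e \<beta>) (e \<gamma>) - 1) - (loop_deviation (e j) (map e js) (e \<beta>) (e \<gamma>) - 1)"
    using Cons.prems e0 er1 by (intro loop_deviation_Cons_mcong[of _ _ _ _ _ \<beta>]) auto
  moreover have "coeff (loop_deviation x (map e js) (e \<beta>) (e \<gamma>)) w = 0"
    using Cons.prems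
    by (intro coeff_loop_deviation_outside[of _ _ _ _ "A \<union> set js \<union> {\<beta>, \<gamma>}"]) (auto simp: e0 er intro!: rx)
  moreover have "coeff (loop_deviation (e j) (map e js) (e \<beta>) (e \<gamma>)) w = 0"
    using Cons.prems
    by (intro coeff_loop_deviation_outside[of _ _ _ _ "insert j (set js) \<union> {\<beta>, \<gamma>}"]) (auto simp: e0 er)
  ultimately have "coeff (loop_deviation x (e j # map e js) (e \<beta>) (e \<gamma>)) w =
      coeff (loop_deviation (x \<odot> e j) (map e js) (e \<beta>) (e \<gamma>)) w"
    using \<open>distinct w\<close> w by (simp add: agree_def coeff_1)
  also have "\<dots> = coeff (loop_deviation (foldl (\<odot>) (x \<odot> e j) (map e js)) [] (e \<beta>) (e \<gamma>)) w"
    using Cons.prems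
    by (intro Cons.IH[of _ "insert j A"]) (auto simp: coeff_loop_mult_Nil e0 restrict_loop_mult rx[OF subset_insertI] er)
  finally show ?case by simp
qed simp

end

section \<open>Multilinear coefficients of the deviations\<close>

text \<open>
  Each factor \<open>E\<close> uses up at least one letter and \<open>q\<close> at least \<open>l\<close> letters.
\<close>

lemma coeff_power_times_short:
  assumes E: "coeff E [] = 0" and q: "\<And>v. length v < l \<Longrightarrow> coeff q v = 0" and "length w < n + l"
  shows "coeff (E ^ n * q) w = 0"
  using assms(3)
proof (induction n arbitrary: w)
  case (Suc n)
  have "coeff E (take k w) * coeff (E ^ n * q) (drop k w) = 0" if "k \<le> length w" for k
  proof (cases "k = 0")
    case False
    then have "coeff (E ^ n * q) (drop k w) = 0"
      using Suc.prems that by (intro Suc.IH) auto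
    then show ?thesis by simp
  qed (simp add: E)
  then show ?case
    by (simp add: mult.assoc coeff_times[of E])
qed (simp add: q)

context letter_weights
begin

text \<open>
  The equation of \<open>associator_mcong\<close> solved for the summand \<open>q\<close> of \<open>rderiv x * q = q - (1 - rderiv x) * q\<close> and iterated \<open>n\<close> times.
\<close>

lemma associator_expansion:
  assumes "coeff x [] = 1" and "\<beta> \<noteq> \<gamma>"
  defines "q \<equiv> loop_deviation x [] (1 + letter \<beta>) (1 + letter \<gamma>) - 1"
  shows "q \<approx> (\<Sum>k<n. (1 - rderiv x) ^ k * (rderiv2 x * (letter \<beta> * letter \<gamma> - letter \<gamma> * letter \<beta>)))
    + (1 - rderiv x) ^ n * q"
proof (induction n)
  case (Suc n)
  let ?E = "1 - rderiv x" and ?T = "rderiv2 x * (letter \<beta> * letter \<gamma> - letter \<gamma> * letter \<beta>)"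
  have "q = rderiv x * q + ?E * q"
    by (simp add: left_diff_distrib)
  also have "\<dots> \<approx> ?T + ?E * q"
    using associator_mcong[OF assms(1,2)] by (intro agree_add agree_refl) (simp add: q_def)
  finally have step: "q \<approx> ?T + ?E * q" .
  note Suc
  also have "(\<Sum>k<n. ?E ^ k * ?T) + ?E ^ n * q \<approx> (\<Sum>k<n. ?E ^ k * ?T) + ?E ^ n * (?T + ?E * q)"
    by (intro agree_add mcong_mult agree_refl step)
  also have "\<dots> = (\<Sum>k<Suc n. ?E ^ k * ?T) + ?E ^ Suc n * q"
    by (simp add: distrib_left power_Suc2 mult.assoc del: power_Suc)
  finally show ?case .
qed simp

lemma restrict_foldl_letters:
  assumes "set js \<inter> A = {}"
  shows "restrict A (foldl (\<odot>) x (map (\<lambda>j. 1 + letter j) js)) = restrict A x"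
  using assms
  by (induction js arbitrary: x) (auto simp: restrict_loop_mult restrict_one_plus_letter)

lemma coeff_foldl_letters_Nil:
  "coeff x [] = 1 \<Longrightarrow> coeff (foldl (\<odot>) x (map (\<lambda>j. 1 + letter j) js)) [] = 1"
  by (induction js arbitrary: x) (auto simp: coeff_loop_mult_Nil coeff_1)

definition letter_product :: "'x list \<Rightarrow> ('x, 'k::comm_ring_1) series" where
  "letter_product js = foldl (\<odot>) 1 (map (\<lambda>j. 1 + letter j) js)"

lemma letter_product_snoc: "letter_product (js @ [j]) = letter_product js \<odot> (1 + letter j)"
  by (simp add: letter_product_def)

lemma coeff_letter_product_Nil: "coeff (letter_product js) [] = 1"
  unfolding letter_product_def by (rule coeff_foldl_letters_Nil) (simp add: coeff_1)

text \<open>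
  The remainder of the geometric series vanishes at the word \<open>w\<close>: each factor \<open>1 - rderiv X\<close> uses up a
  letter, and \<open>q\<close> uses up three, because its words contain \<open>\<beta>\<close>, \<open>\<gamma>\<close> and a letter of \<open>X\<close>.
\<close>

lemma coeff_deviation_multilinear:
  fixes j :: 'x and js :: "'x list"
  defines "X \<equiv> letter_product (j # js) :: ('x, 'k::comm_ring_1) series"
  assumes "distinct (j # js @ [\<beta>, \<gamma>])" "distinct w" "set w = set (j # js @ [\<beta>, \<gamma>])"
  shows "coeff (loop_deviation (1 + letter j) (map (\<lambda>j. 1 + letter j) js) (1 + letter \<beta>) (1 + letter \<gamma>)) w =
    coeff (\<Sum>k<length (j # js). (1 - rderiv X) ^ k *
      (rderiv2 X * (letter \<beta> * letter \<gamma> - letter \<gamma> * letter \<beta>))) w"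
proof -
  define q where "q = loop_deviation X [] (1 + letter \<beta>) (1 + letter \<gamma>) - 1"
  have X: "coeff X [] = 1" unfolding X_def by (rule coeff_letter_product_Nil)
  have X': "X = foldl (\<odot>) (1 + letter j) (map (\<lambda>j. 1 + letter j) js)"
    by (simp add: X_def letter_product_def)
  have expansion: "q \<approx> (\<Sum>k<length (j # js). (1 - rderiv X) ^ k *
      (rderiv2 X * (letter \<beta> * letter \<gamma> - letter \<gamma> * letter \<beta>))) + (1 - rderiv X) ^ length (j # js) * q"
    unfolding q_def by (rule associator_expansion[OF X]) (use assms(2) in simp)
  have w: "w \<noteq> []" using assms(4) by auto
  have lenw: "length w = length js + 3"
    using assms by (metis distinct_card length_append length_Cons list.size(3) add_Suc_right
        numeral_3_eq_3 add_0_right)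
  have "coeff (loop_deviation (1 + letter j) (map (\<lambda>j. 1 + letter j) js) (1 + letter \<beta>) (1 + letter \<gamma>)) w =
      coeff (loop_deviation X [] (1 + letter \<beta>) (1 + letter \<gamma>)) w"
    unfolding X' using assms
    by (intro coeff_loop_deviation_foldl[where A = "{j}"]) (auto simp: coeff_1 restrict_one_plus_letter)
  also have "\<dots> = coeff q w"
    using w by (simp add: q_def coeff_1 del: loop_deviation.simps)
  also have "\<dots> = coeff ((\<Sum>k<length (j # js). (1 - rderiv X) ^ k *
      (rderiv2 X * (letter \<beta> * letter \<gamma> - letter \<gamma> * letter \<beta>))) + (1 - rderiv X) ^ length (j # js) * q) w"
    using expansion assms(3) unfolding agree_def by blast
  finally have main: "coeff (loop_deviation (1 + letter j) (map (\<lambda>j. 1 + letter j) js)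
      (1 + letter \<beta>) (1 + letter \<gamma>)) w = coeff ((\<Sum>k<length (j # js). (1 - rderiv X) ^ k *
      (rderiv2 X * (letter \<beta> * letter \<gamma> - letter \<gamma> * letter \<beta>))) + (1 - rderiv X) ^ length (j # js) * q) w" .
  have zero: "coeff ((1 - rderiv X) ^ length (j # js) * q) w = 0"
  proof (rule coeff_power_times_short)
    show "coeff (1 - rderiv X) [] = 0" using X by (simp add: coeff_rderiv coeff_1)
    show "length w < length (j # js) + 3" using lenw by simp
    fix v :: "'x list" assume v: "length v < 3"
    have const: "\<forall>u\<in>set [X] \<union> {1 + letter \<beta>, 1 + letter \<gamma>}. coeff u [] = 1"
      using X by (simp add: coeff_1)
    have "involves {\<beta>} q" "involves {\<gamma>} q"
      unfolding q_def using const
      by (auto intro!: involves_loop_deviation simp: restrict_one_plus_letter simp del: loop_deviation.simps)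
    moreover have "involves (set (j # js)) q"
      unfolding q_def
    proof (intro involves_loop_deviation const bexI)
      show "restrict (- set (j # js)) X = 1"
        unfolding X_def letter_product_def by (subst restrict_foldl_letters) auto
    qed simp
    ultimately have inv: "involves {\<beta>} q" "involves {\<gamma>} q" "involves (set (j # js)) q"
      by blast+
    show "coeff q v = 0"
    proof (rule ccontr)
      assume "coeff q v \<noteq> 0"
      then have "\<beta> \<in> set v" "\<gamma> \<in> set v" "set v \<inter> set (j # js) \<noteq> {}"
        using inv unfolding involves_def by blast+
      then obtain l where l: "l \<in> set (j # js)" "{l, \<beta>, \<gamma>} \<subseteq> set v"
        by blast
      have "l \<noteq> \<beta>" "l \<noteq> \<gamma>" "\<beta> \<noteq> \<gamma>"
        using l assms(2) by auto
      then have "card {l, \<beta>, \<gamma>} = 3"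
        by simp
      then have "3 \<le> card (set v)"
        using card_mono[of "set v" "{l, \<beta>, \<gamma>}"] l by simp
      then show False
        using v card_length[of v] by simp
    qed
  qed
  show ?thesis
    unfolding main coeff_plus zero by (rule add_0_right)
qed

end

lemma block_N_insert:
  assumes "finite B" "\<And>l. l \<in> B \<Longrightarrow> l < j"
  shows "block_N i (insert j B) = block_N i B * (block_degree i (insert j B) + 1)"
proof -
  have j: "j \<notin> B" using assms(2) by blast
  have "{l. l \<in> insert j B \<and> l \<le> j} = insert j B"
    using assms(2) by (auto intro: less_imp_le)
  moreover have "{l. l \<in> insert j B \<and> l \<le> r} = {l. l \<in> B \<and> l \<le> r}" if "r \<in> B" for r
    using assms(2)[OF that] by auto
  ultimately show ?thesis
    unfolding block_N_def block_degree_def using assms(1) j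
    by (subst prod.insert) (auto simp del: sum.insert intro!: prod.cong)
qed

lemma weight_distinct: "distinct w \<Longrightarrow> weight wt w = (\<Sum>j\<in>set w. wt j)"
  by (simp add: weight_def sum_list_distinct_conv_sum_set)

text \<open>
  Deleting the second occurrence of a letter keeps the letter set and lowers the weight.
\<close>

lemma distinct_if_weight_minimal:
  assumes "\<And>j. j \<in> set w \<Longrightarrow> wt j \<ge> 1" and "weight wt w = (\<Sum>j\<in>set w. wt j)"
  shows "distinct w"
proof (rule ccontr)
  assume "\<not> distinct w"
  then obtain xs ys zs y where w: "w = xs @ [y] @ ys @ [y] @ zs"
    using not_distinct_decomp by blast
  have le: "(\<Sum>j\<in>set v. wt j) \<le> weight wt v" for v
    by (induction v) (auto simp: sum.insert_if)
  have "set (xs @ [y] @ ys @ zs) = set w" using w by auto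
  then have "(\<Sum>j\<in>set w. wt j) \<le> weight wt (xs @ [y] @ ys @ zs)"
    using le by metis
  also have "\<dots> < weight wt w"
    using assms(1)[of y] w by simp
  finally show False using assms(2) by simp
qed

locale numbered_letter_weights = letter_weights wt for wt :: "nat \<Rightarrow> nat"
begin

text \<open>
  Multiplying by \<open>1 + letter (Suc m)\<close> appends the largest letter to a word \<open>u\<close> with the factor
  \<open>weight wt u + 1\<close>, which is the coefficient of \<open>u\<close> under \<open>rderiv\<close>. Taking \<open>rderiv\<close> again supplies the
  last factor of \<open>N(B)\<close>.
\<close>

lemma coeff_rderiv_letter_product:
  assumes "distinct w"
  shows "coeff (rderiv (letter_product [1..<m+1])) w =
    (if sorted_wrt (<) w \<and> set w \<subseteq> {1..m} then of_nat (block_N wt (set w)) else (0 :: 'k::comm_ring_1))"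
  using assms
proof (induction m arbitrary: w)
  case 0
  then show ?case by (auto simp: letter_product_def coeff_1 block_N_def)
next
  case (Suc m)
  let ?X = "\<lambda>m. letter_product [1..<m+1] :: (nat, 'k) series"
  have "rderiv (?X (Suc m)) \<approx> rderiv (?X m + rderiv (?X m) * letter (Suc m))"
    using rderiv_mcong[OF loop_mult_letter, of "?X m" "Suc m"] by (simp add: letter_product_snoc[symmetric])
  then have X: "coeff (rderiv (?X (Suc m))) w = coeff (rderiv (?X m)) w
      + of_nat (weight wt w + 1) * (if w \<noteq> [] \<and> last w = Suc m then coeff (rderiv (?X m)) (butlast w) else 0)"
    using Suc.prems unfolding rderiv_add agree_def coeff_plus coeff_rderiv[of "_ * _"] coeff_times_letter
    by blast
  show ?case
  proof (cases w rule: rev_cases)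
    case Nil
    then show ?thesis using X Suc.IH[of "[]"] by (simp del: upt_Suc)
  next
    case (snoc u l)
    have u: "distinct u" "l \<notin> set u" using Suc.prems snoc by auto
    show ?thesis
    proof (cases "l = Suc m")
      case True
      have lt: "r < Suc m" if "r \<in> set u" "set u \<subseteq> {1..Suc m}" for r
        using that u True by (metis atLeastAtMost_iff le_neq_implies_less subsetD)
      have iff: "sorted_wrt (<) w \<and> set w \<subseteq> {1..Suc m} \<longleftrightarrow> sorted_wrt (<) u \<and> set u \<subseteq> {1..m}"
        using lt True by (auto simp: snoc sorted_wrt_append) fastforce+
      have "block_N wt (set w) = block_N wt (set u) * (weight wt w + 1)" if "set u \<subseteq> {1..m}"
        using block_N_insert[of "set u" "Suc m" wt] that weight_distinct[OF Suc.prems, of wt]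
        by (fastforce simp: snoc True block_degree_def)
      then show ?thesis
        unfolding X iff Suc.IH[OF Suc.prems] using snoc True Suc.IH[OF u(1)]
        by (auto simp: algebra_simps)
    next
      case False
      have "sorted_wrt (<) w \<and> set w \<subseteq> {1..Suc m} \<longleftrightarrow> sorted_wrt (<) w \<and> set w \<subseteq> {1..m}"
        using False by (auto simp: snoc sorted_wrt_append le_Suc_eq) fastforce+
      then show ?thesis
        unfolding X Suc.IH[OF Suc.prems] using snoc False by simp
    qed
  qed
qed

end

section \<open>Evaluation in a graded algebra\<close>

lemma length_le_weight:
  assumes "\<And>j. j \<in> set w \<Longrightarrow> wt j \<ge> 1"
  shows "length w \<le> weight wt w"
  using assms by (induction w) (fastforce simp: Suc_le_eq)+

context graded_algebra
begin

definition uscale :: "'k \<Rightarrow> 'k \<times> 'a \<Rightarrow> 'k \<times> 'a" where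
  "uscale t u = (t * fst u, scale t (snd u))"

lemma umult_assoc: "umult (umult u v) w = umult u (umult v w)"
  by (simp add: umult_def scale_mult_left scale_mult_right scale_right_distrib
      scale_left_commute distrib_left distrib_right mult.assoc algebra_simps
      flip: scale_mult_left scale_mult_right)

lemma umult_one [simp]: "umult (1, 0) u = u" "umult u (1, 0) = u"
  by (simp_all add: umult_def prod_eq_iff)

lemma umult_0 [simp]: "umult 0 u = 0" "umult u 0 = 0"
  by (simp_all add: umult_def zero_prod_def)

lemma umult_add: "umult (u + v) w = umult u w + umult v w" "umult u (v + w) = umult u v + umult u w"
  by (simp_all add: umult_def prod_eq_iff algebra_simps scale_right_distrib scale_left_distrib)

lemma umult_sum_left: "umult (\<Sum>x\<in>X. f x) u = (\<Sum>x\<in>X. umult (f x) u)"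
  and umult_sum_right: "umult u (\<Sum>x\<in>X. f x) = (\<Sum>x\<in>X. umult u (f x))"
  by (induction X rule: infinite_finite_induct) (simp_all add: umult_add)

lemma uscale_simps [simp]: "uscale 0 u = 0" "uscale 1 u = u" "uscale t 0 = 0"
  by (simp_all add: uscale_def zero_prod_def)

lemma uscale_add: "uscale (s + t) u = uscale s u + uscale t u"
  by (simp add: uscale_def prod_eq_iff algebra_simps scale_left_distrib)

lemma uscale_sum: "uscale (\<Sum>x\<in>X. f x) u = (\<Sum>x\<in>X. uscale (f x) u)"
  by (induction X rule: infinite_finite_induct) (simp_all add: uscale_add)

lemma umult_uscale: "umult (uscale s u) (uscale t v) = uscale (s * t) (umult u v)"
  by (simp add: umult_def uscale_def scale_right_distrib ac_simps
      flip: scale_mult_left scale_mult_right)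

lemma spow_Suc: "spow u (Suc k) = smult u (spow u k)"
  by (simp add: spow_def)

lemma spow_1: "spow u (Suc 0) = u"
proof
  fix n
  have "smult u sone n = (\<Sum>i\<in>{n}. umult (u i) (sone (n - i)))"
    unfolding smult_def by (rule sum.mono_neutral_right) (auto simp: sone_def)
  then show "spow u (Suc 0) n = u n"
    by (simp add: spow_def sone_def)
qed

lemma spow_cong_below:
  assumes "\<And>k. k \<le> n \<Longrightarrow> u k = v k"
  shows "spow u l n = spow v l n"
  using assms
  by (induction l arbitrary: n) (simp_all add: spow_def smult_def)

text \<open>
  The summand \<open>m = 0\<close> of \<open>comp x q n\<close> is \<open>q n\<close>, and the others use only components of \<open>q\<close> below \<open>n\<close>.
\<close>

lemma inj_on_comp:
  assumes "x \<in> J 1"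
  shows "inj_on (comp x) (J 1)"
proof (rule inj_onI, rule ext)
  fix u v n assume u: "u \<in> J 1" and v: "v \<in> J 1" and eq: "comp x u = comp x v"
  show "u n = v n"
  proof (induction n rule: less_induct)
    case (less n)
    have split: "comp x q n = q n + (\<Sum>m=1..n. umult (x m) (spow q (m + 1) (n - m)))" for q
    proof -
      have "{..n} = insert 0 {1..n}" by auto
      then show ?thesis
        using assms by (simp add: comp_def J_def spow_1)
    qed
    have "(\<Sum>m=1..n. umult (x m) (spow u (m + 1) (n - m))) = (\<Sum>m=1..n. umult (x m) (spow v (m + 1) (n - m)))"
      by (intro sum.cong arg_cong2[of _ _ _ _ umult] spow_cong_below less) auto
    then show ?case
      using fun_cong[OF eq, of n] by (simp only: split add_right_cancel)
  qed
qed

lemma P_Cons: "P (x # xs) y z = deviation_rev (replicate (length xs) 1) (x # xs @ [y, z])"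
  by (simp add: P_def deviation_def)

end

text \<open>
  Letters \<open>j \<in> A\<close> are sent to elements \<open>val j\<close> of degree \<open>wt j\<close>. Positive weights and a finite alphabet
  leave finitely many words of each weight, which makes evaluation a finite sum in each degree.
\<close>

locale graded_valuation = graded_algebra scale S + letter_weights wt
  for scale :: "'k::field_char_0 \<Rightarrow> 'a::ring \<Rightarrow> 'a" and S and wt :: "'x \<Rightarrow> nat" +
  fixes A :: "'x set" and val :: "'x \<Rightarrow> 'a"
  assumes finite_A: "finite A"
    and wt_pos: "j \<in> A \<Longrightarrow> wt j \<ge> 1"
    and val_S: "j \<in> A \<Longrightarrow> val j \<in> S (wt j)"
begin

definition words :: "nat \<Rightarrow> 'x list set" where
  "words n = {w. set w \<subseteq> A \<and> weight wt w = n}"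

definition uword :: "'x list \<Rightarrow> 'k \<times> 'a" where
  "uword w = foldr (\<lambda>j. umult (0, val j)) w (1, 0)"

definition eval :: "('x, 'k) series \<Rightarrow> nat \<Rightarrow> 'k \<times> 'a" where
  "eval F n = (\<Sum>w\<in>words n. uscale (coeff F w) (uword w))"

lemma uword_simps [simp]: "uword [] = (1, 0)" "uword (j # w) = umult (0, val j) (uword w)"
  by (simp_all add: uword_def)

lemma uword_append: "uword (u @ v) = umult (uword u) (uword v)"
  by (induction u) (simp_all add: umult_assoc)

lemma finite_words: "finite (words n)"
proof (rule finite_subset)
  show "words n \<subseteq> {w. set w \<subseteq> A \<and> length w \<le> n}"
    using length_le_weight[of _ wt] wt_pos by (fastforce simp: words_def)
qed (rule finite_lists_length_le[OF finite_A])

lemma words_0: "words 0 = {[]}"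
proof -
  have "w = []" if "w \<in> words 0" for w
  proof -
    have "length w \<le> weight wt w"
      using that wt_pos by (intro length_le_weight) (auto simp: words_def)
    then show ?thesis using that by (simp add: words_def)
  qed
  then show ?thesis by (auto simp: words_def)
qed

lemma sum_words_split:
  fixes h :: "'x list \<Rightarrow> 'x list \<Rightarrow> 'b::comm_monoid_add"
  shows "(\<Sum>w\<in>words n. \<Sum>k\<le>length w. h (take k w) (drop k w)) =
    (\<Sum>i\<le>n. \<Sum>u\<in>words i. \<Sum>v\<in>words (n - i). h u v)"
proof -
  have "(\<Sum>w\<in>words n. \<Sum>k\<le>length w. h (take k w) (drop k w)) =
      (\<Sum>(w, k)\<in>Sigma (words n) (\<lambda>w. {..length w}). h (take k w) (drop k w))"
    by (rule sum.Sigma) (auto simp: finite_words)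
  also have "\<dots> = (\<Sum>(i, u, v)\<in>Sigma {..n} (\<lambda>i. words i \<times> words (n - i)). h u v)"
  proof (rule sum.reindex_bij_witness[of _ "\<lambda>(i, u, v). (u @ v, length u)"
        "\<lambda>(w, k). (weight wt (take k w), take k w, drop k w)"], goal_cases)
    case (2 wk)
    then obtain w k where wk: "wk = (w, k)" "w \<in> words n" by auto
    have "weight wt (take k w) + weight wt (drop k w) = weight wt w"
      by (metis append_take_drop_id weight_simps(3))
    then show ?case
      using wk set_subset_take_drop[of w A k] by (auto simp: words_def)
  qed (auto simp: words_def)
  also have "\<dots> = (\<Sum>i\<le>n. \<Sum>(u, v)\<in>words i \<times> words (n - i). h u v)"
    by (rule sum.Sigma[symmetric]) (auto simp: finite_words)
  also have "\<dots> = (\<Sum>i\<le>n. \<Sum>u\<in>words i. \<Sum>v\<in>words (n - i). h u v)"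
    by (simp add: sum.cartesian_product)
  finally show ?thesis .
qed

lemma eval_add: "eval (F + G) n = eval F n + eval G n"
  by (simp add: eval_def uscale_add sum.distrib)

lemma eval_1: "eval 1 = sone"
proof
  fix n
  have "(\<Sum>w\<in>words n. uscale (coeff 1 w) (uword w)) = (\<Sum>w\<in>words n. if w = [] then (1, 0) else 0)"
    by (intro sum.cong) (auto simp: coeff_1)
  then show "eval 1 n = sone n"
    by (simp add: eval_def finite_words sone_def) (simp add: words_def)
qed

lemma eval_letter: "j \<in> A \<Longrightarrow> eval (letter j) n = (if n = wt j then (0, val j) else 0)"
proof -
  assume "j \<in> A"
  have "(\<Sum>w\<in>words n. uscale (coeff (letter j) w) (uword w)) =
      (\<Sum>w\<in>words n. if w = [j] then (0, val j) else 0)"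
    by (intro sum.cong) auto
  then show ?thesis
    using \<open>j \<in> A\<close> by (simp add: eval_def finite_words) (auto simp: words_def)
qed

lemma eval_one_plus_letter:
  assumes "j \<in> A"
  shows "eval (1 + letter j) = one_plus (wt j) (val j)"
  using wt_pos[OF assms] by (auto simp: eval_add eval_1 eval_letter[OF assms] one_plus_def sone_def fun_eq_iff)

lemma eval_mult: "eval (F * G) = smult (eval F) (eval G)"
proof
  fix n
  let ?h = "\<lambda>u v. umult (uscale (coeff F u) (uword u)) (uscale (coeff G v) (uword v))"
  have "eval (F * G) n = (\<Sum>w\<in>words n. \<Sum>k\<le>length w. ?h (take k w) (drop k w))"
    unfolding eval_def coeff_times uscale_sum umult_uscale uword_append[symmetric] append_take_drop_id ..
  also have "\<dots> = (\<Sum>i\<le>n. \<Sum>u\<in>words i. \<Sum>v\<in>words (n - i). ?h u v)"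
    by (rule sum_words_split)
  finally show "eval (F * G) n = smult (eval F) (eval G) n"
    unfolding smult_def eval_def umult_sum_left unfolding umult_sum_right .
qed

lemma eval_power: "eval (F ^ k) = spow (eval F) k"
  by (induction k) (simp_all add: eval_1 eval_mult spow_Suc, simp add: spow_def)

lemma eval_loop_mult: "eval (F \<odot> G) = comp (eval F) (eval G)"
proof
  fix n
  let ?h = "\<lambda>u v. umult (uscale (coeff F u) (uword u)) (uscale (coeff (G ^ (weight wt u + 1)) v) (uword v))"
  have "eval (F \<odot> G) n = (\<Sum>w\<in>words n. \<Sum>k\<le>length w. ?h (take k w) (drop k w))"
    unfolding eval_def coeff_loop_mult uscale_sum umult_uscale uword_append[symmetric] append_take_drop_id ..
  also have "\<dots> = (\<Sum>i\<le>n. \<Sum>u\<in>words i. \<Sum>v\<in>words (n - i). ?h u v)"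
    by (rule sum_words_split)
  also have "\<dots> = (\<Sum>i\<le>n. umult (eval F i) (eval (G ^ (i + 1)) (n - i)))"
    unfolding eval_def umult_sum_left unfolding umult_sum_right
    by (intro sum.cong refl) (simp add: words_def)
  finally show "eval (F \<odot> G) n = comp (eval F) (eval G) n"
    unfolding comp_def eval_power .
qed

lemma uword_S:
  assumes "set w \<subseteq> A" "w \<noteq> []"
  shows "fst (uword w) = 0 \<and> snd (uword w) \<in> S (weight wt w)"
  using assms
proof (induction w)
  case (Cons j w)
  show ?case
  proof (cases "w = []")
    case True
    then show ?thesis using Cons val_S by simp
  next
    case False
    then obtain l v where w: "w = l # v" by (cases w) auto
    have "weight wt w \<ge> 1" using Cons wt_pos[of l] w by simp
    then have "val j * snd (uword w) \<in> S (wt j + weight wt w)"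
      using Cons False by (intro mult_S wt_pos val_S) auto
    then show ?thesis using Cons False by (simp add: umult_def)
  qed
qed simp

lemma eval_J:
  assumes "coeff F [] = 1"
  shows "eval F \<in> J 1"
proof -
  have "fst (eval F n) = 0 \<and> snd (eval F n) \<in> S n" if n: "n \<ge> 1" for n
  proof -
    have "fst (uword w) = 0 \<and> snd (uword w) \<in> S n" if "w \<in> words n" for w
      using that n uword_S[of w] by (cases "w = []") (auto simp: words_def)
    then show ?thesis
      unfolding eval_def fst_sum snd_sum uscale_def fst_conv snd_conv using subspace_S[OF n]
      by (auto intro!: sum.neutral subspace_sum subspace_scale)
  qed
  then show ?thesis
    using assms by (auto simp: J_def eval_def[of _ 0] words_0)
qed

text \<open>
  The image of the quotient of series solves the equation that defines the quotient of the images, and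
  the solution is unique by \<open>inj_on_comp\<close>.
\<close>

lemma eval_loop_ldiv:
  assumes "coeff x [] = 1" "coeff y [] = 1"
  shows "ldiv (eval x) (eval y) = eval (loop_ldiv x y)"
proof -
  have "comp (eval x) (eval (loop_ldiv x y)) = eval y"
    using assms by (simp add: eval_loop_mult[symmetric] loop_mult_ldiv)
  then show ?thesis
    unfolding ldiv_def using assms
    by (intro inv_into_f_eq inj_on_comp eval_J) (auto simp: coeff_loop_ldiv_Nil)
qed

lemma eval_loop_deviation:
  assumes "\<forall>u\<in>set (x # xs) \<union> {y, z}. coeff u [] = 1"
  shows "deviation_rev (replicate (length xs) 1) (eval x # map eval xs @ [eval y, eval z]) =
    eval (loop_deviation x xs y z)"
  using assms
proof (induction xs arbitrary: x)
  case Nil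
  then show ?case
    by (simp add: associator_def eval_loop_mult[symmetric] eval_loop_ldiv coeff_loop_mult_Nil)
next
  case (Cons x' xs)
  have IH: "deviation_rev (replicate (length xs) (Suc 0)) (eval u # map eval xs @ [eval y, eval z]) =
      eval (loop_deviation u xs y z)" if "coeff u [] = 1" for u
    using Cons.IH[of u] Cons.prems that by simp
  have "coeff (loop_deviation u xs y z) [] = 1" if "coeff u [] = 1" for u
    using Cons.prems that by (intro coeff_loop_deviation_Nil) auto
  then show ?case
    using Cons.prems
    by (simp add: Let_def IH eval_loop_mult[symmetric] eval_loop_ldiv coeff_loop_mult_Nil)
qed

lemma P_eval:
  assumes "\<forall>u\<in>set (x # xs) \<union> {y, z}. coeff u [] = 1"
  shows "P (eval x # map eval xs) (eval y) (eval z) = eval (loop_deviation x xs y z)"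
  using eval_loop_deviation[OF assms] by (simp add: P_Cons)

end

section \<open>Arrangements and ordered partitions\<close>

definition arrangements :: "'x set \<Rightarrow> 'x list set" where
  "arrangements A = {w. distinct w \<and> set w = A}"

lemma finite_arrangements [simp]: "finite A \<Longrightarrow> finite (arrangements A)"
  by (rule finite_subset[OF _ finite_subset_distinct]) (auto simp: arrangements_def)

text \<open>
  Cutting an arrangement of \<open>A\<close> in two is choosing the set \<open>B\<close> of its first letters and arranging \<open>B\<close> and
  its complement; this turns coefficients of products into sums over subsets.
\<close>

lemma sum_arrangements_split:
  fixes h :: "'x list \<Rightarrow> 'x list \<Rightarrow> 'b::comm_monoid_add"
  assumes "finite A"
  shows "(\<Sum>w\<in>arrangements A. \<Sum>k\<le>length w. h (take k w) (drop k w)) =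
    (\<Sum>B\<in>Pow A. \<Sum>u\<in>arrangements B. \<Sum>v\<in>arrangements (A - B). h u v)"
proof -
  have "(\<Sum>w\<in>arrangements A. \<Sum>k\<le>length w. h (take k w) (drop k w)) =
      (\<Sum>(w, k)\<in>Sigma (arrangements A) (\<lambda>w. {..length w}). h (take k w) (drop k w))"
    by (rule sum.Sigma) (auto simp: assms)
  also have "\<dots> = (\<Sum>(B, u, v)\<in>Sigma (Pow A) (\<lambda>B. arrangements B \<times> arrangements (A - B)). h u v)"
  proof (rule sum.reindex_bij_witness[of _ "\<lambda>(B, u, v). (u @ v, length u)"
        "\<lambda>(w, k). (set (take k w), take k w, drop k w)"], goal_cases)
    case (2 wk)
    then obtain w k where wk: "wk = (w, k)" "distinct w" "set w = A" by (auto simp: arrangements_def)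
    have "set (take k w) \<union> set (drop k w) = A" "set (take k w) \<inter> set (drop k w) = {}"
      using wk set_take_disj_set_drop_if_distinct[of w k k]
      by (metis append_take_drop_id set_append, simp)
    then show ?case using wk by (auto simp: arrangements_def)
  qed (auto simp: arrangements_def)
  also have "\<dots> = (\<Sum>B\<in>Pow A. \<Sum>(u, v)\<in>arrangements B \<times> arrangements (A - B). h u v)"
    by (rule sum.Sigma[symmetric]) (auto simp: assms intro!: finite_cartesian_product finite_arrangements intro: finite_subset[OF _ assms])
  finally show ?thesis
    by (simp add: sum.cartesian_product)
qed

text \<open>
  The increasing arrangement of a finite set is unique.
\<close>

lemma sum_arrangements_sorted:
  fixes B :: "'x::linorder set"
  assumes "finite B"
    and "\<And>u. u \<in> arrangements B \<Longrightarrow> \<not> sorted_wrt (<) u \<Longrightarrow> f u = 0"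
  shows "(\<Sum>u\<in>arrangements B. f u) = f (sorted_list_of_set B)"
proof -
  have "(\<Sum>u\<in>arrangements B. f u) = (\<Sum>u\<in>{sorted_list_of_set B}. f u)"
  proof (rule sum.mono_neutral_right)
    show "\<forall>u\<in>arrangements B - {sorted_list_of_set B}. f u = 0"
      using assms by (auto simp: arrangements_def) (metis sorted_list_of_set.idem_if_sorted_distinct strict_sorted_iff)
  qed (use assms(1) in simp, use assms(1) in \<open>simp add: arrangements_def\<close>)
  then show ?thesis by simp
qed

lemma ordered_partitions_0: "ordered_partitions 0 A = (if A = {} then {[]} else {})"
  by (auto simp: ordered_partitions_def)

lemma Cons_in_ordered_partitions:
  "B # Bs \<in> ordered_partitions (Suc k) A \<longleftrightarrow> B \<noteq> {} \<and> B \<subseteq> A \<and> Bs \<in> ordered_partitions k (A - B)"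
proof (cases "length Bs = k")
  case True
  have "(\<forall>q<Suc k. \<forall>r<Suc k. q \<noteq> r \<longrightarrow> (B # Bs) ! q \<inter> (B # Bs) ! r = {}) \<longleftrightarrow>
      (\<forall>r<k. B \<inter> Bs ! r = {}) \<and> (\<forall>q<k. \<forall>r<k. q \<noteq> r \<longrightarrow> Bs ! q \<inter> Bs ! r = {})"
    unfolding All_less_Suc2 by (simp add: Int_commute[of _ B]) blast
  also have "(\<forall>r<k. B \<inter> Bs ! r = {}) \<longleftrightarrow> (\<forall>C\<in>set Bs. B \<inter> C = {})"
    using True by (simp add: all_set_conv_all_nth)
  also have "\<dots> \<longleftrightarrow> B \<inter> \<Union>(set Bs) = {}"
    by blast
  finally have disj: "(\<forall>q<Suc k. \<forall>r<Suc k. q \<noteq> r \<longrightarrow> (B # Bs) ! q \<inter> (B # Bs) ! r = {}) \<longleftrightarrow>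
      B \<inter> \<Union>(set Bs) = {} \<and> (\<forall>q<k. \<forall>r<k. q \<noteq> r \<longrightarrow> Bs ! q \<inter> Bs ! r = {})" .
  have cover: "\<Union>(set (B # Bs)) = A \<and> B \<inter> \<Union>(set Bs) = {} \<longleftrightarrow> B \<subseteq> A \<and> \<Union>(set Bs) = A - B"
    unfolding list.set(2) Union_insert by blast
  have ne: "(\<forall>C\<in>set (B # Bs). C \<noteq> {}) \<longleftrightarrow> B \<noteq> {} \<and> (\<forall>C\<in>set Bs. C \<noteq> {})"
    by simp
  show ?thesis
    unfolding ordered_partitions_def mem_Collect_eq disj ne using cover True by auto
qed (simp add: ordered_partitions_def)

lemma ordered_partitions_Suc:
  "ordered_partitions (Suc k) A = (\<lambda>(B, Bs). B # Bs) ` Sigma (Pow A - {{}}) (\<lambda>B. ordered_partitions k (A - B))"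
proof (rule set_eqI)
  fix Cs
  show "Cs \<in> ordered_partitions (Suc k) A \<longleftrightarrow>
      Cs \<in> (\<lambda>(B, Bs). B # Bs) ` Sigma (Pow A - {{}}) (\<lambda>B. ordered_partitions k (A - B))"
  proof (cases Cs)
    case Nil
    then show ?thesis by (auto simp: ordered_partitions_def)
  next
    case (Cons B Bs)
    then show ?thesis by (auto simp: Cons_in_ordered_partitions image_iff)
  qed
qed

lemma finite_ordered_partitions: "finite A \<Longrightarrow> finite (ordered_partitions k A)"
  by (induction k arbitrary: A) (auto simp: ordered_partitions_0 ordered_partitions_Suc)

lemma sum_ordered_partitions_Suc:
  assumes "finite A"
  shows "(\<Sum>Bs\<in>ordered_partitions (Suc k) A. f Bs) =
    (\<Sum>B\<in>Pow A - {{}}. \<Sum>Bs\<in>ordered_partitions k (A - B). f (B # Bs))"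
proof -
  have "(\<Sum>Bs\<in>ordered_partitions (Suc k) A. f Bs) =
      (\<Sum>(B, Bs)\<in>Sigma (Pow A - {{}}) (\<lambda>B. ordered_partitions k (A - B)). f (B # Bs))"
    unfolding ordered_partitions_Suc
    by (subst sum.reindex) (auto simp: inj_on_def intro!: sum.cong)
  also have "\<dots> = (\<Sum>B\<in>Pow A - {{}}. \<Sum>Bs\<in>ordered_partitions k (A - B). f (B # Bs))"
    by (rule sum.Sigma[symmetric]) (auto simp: assms finite_ordered_partitions)
  finally show ?thesis .
qed

lemma ordered_partitions_1: "ordered_partitions (Suc 0) A = (if A = {} then {} else {[A]})"
  by (auto simp: ordered_partitions_def length_Suc_conv)

lemma arrangements_pair:
  assumes "x \<noteq> y"
  shows "arrangements {x, y} = {[x, y], [y, x]}"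
proof
  show "arrangements {x, y} \<subseteq> {[x, y], [y, x]}"
  proof
    fix w assume w: "w \<in> arrangements {x, y}"
    then have "length w = 2"
      using assms distinct_card[of w] by (simp add: arrangements_def)
    then obtain s t where "w = [s, t]"
      by (auto simp: numeral_2_eq_2 length_Suc_conv)
    with w show "w \<in> {[x, y], [y, x]}"
      by (auto simp: arrangements_def doubleton_eq_iff)
  qed
qed (use assms in \<open>auto simp: arrangements_def\<close>)

section \<open>The leading component of a deviation\<close>

lemma foldr_times_diff:
  fixes x y :: "'a::ring"
  shows "foldr (*) ws (x - y) = foldr (*) ws x - foldr (*) ws y"
  by (induction ws) (simp_all add: right_diff_distrib)

locale numbered_graded_valuation = graded_valuation scale S wt A val + numbered_letter_weights wt
  for scale :: "'k::field_char_0 \<Rightarrow> 'a::ring \<Rightarrow> 'a" and S and wt :: "nat \<Rightarrow> nat"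
    and A :: "nat set" and val :: "nat \<Rightarrow> 'a"
begin

text \<open>
  As \<open>2 * ((n + 1) choose 2) = n * (n + 1)\<close>, doubling \<open>rderiv2\<close> is \<open>rderiv\<close> followed by multiplication with
  the weight.
\<close>

lemma coeff_2_rderiv2_letter_product:
  assumes "distinct w"
  shows "coeff (of_nat 2 * rderiv2 (letter_product [1..<m+1])) w =
    (if sorted_wrt (<) w \<and> set w \<subseteq> {1..m}
     then of_nat (block_degree wt (set w)) * of_nat (block_N wt (set w)) else (0::'k))"
proof -
  let ?n = "weight wt w"
  have "2 * ((?n + 1) choose 2) = ?n * (?n + 1)"
    by (simp add: choose_two)
  then have "(of_nat 2 * of_nat ((?n + 1) choose 2) :: 'k) = of_nat ?n * of_nat (?n + 1)"
    by (metis of_nat_mult)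
  then have "coeff (of_nat 2 * rderiv2 (letter_product [1..<m+1])) w =
      of_nat ?n * (coeff (rderiv (letter_product [1..<m+1])) w :: 'k)"
    unfolding coeff_of_nat_times coeff_rderiv coeff_rderiv2 by (simp only: mult.assoc[symmetric])
  then show ?thesis
    unfolding coeff_rderiv_letter_product[OF assms]
    by (simp add: weight_distinct[OF assms] block_degree_def)
qed

lemma coeff_1_minus_rderiv_letter_product:
  assumes "distinct w"
  shows "coeff (1 - rderiv (letter_product [1..<m+1])) w =
    (if sorted_wrt (<) w \<and> set w \<subseteq> {1..m} \<and> w \<noteq> [] then - of_nat (block_N wt (set w)) else (0::'k))"
  unfolding coeff_minus coeff_rderiv_letter_product[OF assms] by (auto simp: coeff_1 block_N_def)

text \<open>
  Each factor \<open>1 - rderiv X\<close> is supported on nonempty increasing words and contributes one block, with the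
  coefficient \<open>-N(C)\<close>; the last factor contributes the last block and its degree. Induction on \<open>k\<close>
  splits off the first block on both sides.
\<close>

lemma sum_arrangements_eq_sum_ordered_partitions:
  fixes \<phi> :: "nat list \<Rightarrow> 'a"
  assumes "B \<subseteq> {1..m}"
  defines "X \<equiv> letter_product [1..<m+1]"
  shows "(\<Sum>w\<in>arrangements B. scale (coeff ((1 - rderiv X) ^ k * (of_nat 2 * rderiv2 X)) w) (\<phi> w)) =
    (\<Sum>Bs\<in>ordered_partitions (Suc k) B.
       scale ((-1) ^ k * of_nat (block_degree wt (last Bs)) * of_nat (\<Prod>C\<leftarrow>Bs. block_N wt C))
         (\<phi> (concat (map sorted_list_of_set Bs))))"
  using assms(1)
proof (induction k arbitrary: B \<phi>)
  case 0
  then have B: "finite B" by (rule finite_subset) simp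
  have "(\<Sum>w\<in>arrangements B. scale (coeff ((1 - rderiv X) ^ 0 * (of_nat 2 * rderiv2 X)) w) (\<phi> w)) =
      scale (coeff (of_nat 2 * rderiv2 X) (sorted_list_of_set B)) (\<phi> (sorted_list_of_set B))"
    unfolding power_0 mult_1_left
    by (rule sum_arrangements_sorted[OF B]) (simp only: arrangements_def mem_Collect_eq
        coeff_2_rderiv2_letter_product[of _ m, folded X_def] if_False scale_zero_left simp_thms)
  also have "coeff (of_nat 2 * rderiv2 X) (sorted_list_of_set B) =
      of_nat (block_degree wt B) * of_nat (block_N wt B)"
    unfolding X_def using 0 B
    by (subst coeff_2_rderiv2_letter_product) auto
  finally show ?case
    by (auto simp: ordered_partitions_1 block_degree_def)
next
  case (Suc k)
  define E where "E = 1 - rderiv X"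
  define G where "G = E ^ k * (of_nat 2 * rderiv2 X)"
  have B: "finite B" using Suc.prems by (rule finite_subset) simp
  have "(\<Sum>w\<in>arrangements B. scale (coeff (E ^ Suc k * (of_nat 2 * rderiv2 X)) w) (\<phi> w)) =
      (\<Sum>w\<in>arrangements B. \<Sum>l\<le>length w. scale (coeff E (take l w) * coeff G (drop l w)) (\<phi> (take l w @ drop l w)))"
    by (simp only: power_Suc mult.assoc G_def coeff_times[of E] scale_sum_left append_take_drop_id)
  also have "\<dots> = (\<Sum>C\<in>Pow B. \<Sum>u\<in>arrangements C. \<Sum>v\<in>arrangements (B - C).
      scale (coeff E u * coeff G v) (\<phi> (u @ v)))"
    by (rule sum_arrangements_split[OF B])
  also have "\<dots> = (\<Sum>C\<in>Pow B. scale (coeff E (sorted_list_of_set C))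
      (\<Sum>v\<in>arrangements (B - C). scale (coeff G v) (\<phi> (sorted_list_of_set C @ v))))"
  proof (rule sum.cong[OF refl])
    fix C assume "C \<in> Pow B"
    then have C: "finite C" using B by (auto intro: finite_subset)
    have "(\<Sum>u\<in>arrangements C. scale (coeff E u) (\<Sum>v\<in>arrangements (B - C). scale (coeff G v) (\<phi> (u @ v)))) =
        scale (coeff E (sorted_list_of_set C))
          (\<Sum>v\<in>arrangements (B - C). scale (coeff G v) (\<phi> (sorted_list_of_set C @ v)))"
      by (rule sum_arrangements_sorted[OF C])
         (simp only: arrangements_def mem_Collect_eq
        coeff_1_minus_rderiv_letter_product[of _ m, folded X_def, folded E_def] if_False scale_zero_left simp_thms)
    then show "(\<Sum>u\<in>arrangements C. \<Sum>v\<in>arrangements (B - C). scale (coeff E u * coeff G v) (\<phi> (u @ v))) =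
        scale (coeff E (sorted_list_of_set C))
          (\<Sum>v\<in>arrangements (B - C). scale (coeff G v) (\<phi> (sorted_list_of_set C @ v)))"
      by (simp add: scale_sum_right)
  qed
  also have "\<dots> = (\<Sum>C\<in>Pow B - {{}}. scale (coeff E (sorted_list_of_set C))
      (\<Sum>v\<in>arrangements (B - C). scale (coeff G v) (\<phi> (sorted_list_of_set C @ v))))"
    using B coeff_1_minus_rderiv_letter_product[of "[]" m, folded X_def, folded E_def]
    by (intro sum.mono_neutral_right) auto
  also have "\<dots> = (\<Sum>C\<in>Pow B - {{}}. \<Sum>Bs\<in>ordered_partitions (Suc k) (B - C).
       scale ((-1) ^ Suc k * of_nat (block_degree wt (last (C # Bs))) * of_nat (\<Prod>C\<leftarrow>C # Bs. block_N wt C))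
         (\<phi> (concat (map sorted_list_of_set (C # Bs)))))"
  proof (rule sum.cong[OF refl])
    fix C assume C: "C \<in> Pow B - {{}}"
    then have "finite C" using B by (auto intro: finite_subset)
    then have E: "coeff E (sorted_list_of_set C) = - of_nat (block_N wt C)"
      unfolding E_def X_def using C Suc.prems
      by (subst coeff_1_minus_rderiv_letter_product) auto
    have "(\<Sum>v\<in>arrangements (B - C). scale (coeff G v) (\<phi> (sorted_list_of_set C @ v))) =
        (\<Sum>Bs\<in>ordered_partitions (Suc k) (B - C).
          scale ((-1) ^ k * of_nat (block_degree wt (last Bs)) * of_nat (\<Prod>C\<leftarrow>Bs. block_N wt C))
            (\<phi> (sorted_list_of_set C @ concat (map sorted_list_of_set Bs))))"
      unfolding G_def E_def using Suc.prems by (intro Suc.IH) auto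
    moreover have "Bs \<noteq> []" if "Bs \<in> ordered_partitions (Suc k) (B - C)" for Bs
      using that by (auto simp: ordered_partitions_def)
    ultimately show "scale (coeff E (sorted_list_of_set C))
        (\<Sum>v\<in>arrangements (B - C). scale (coeff G v) (\<phi> (sorted_list_of_set C @ v))) =
      (\<Sum>Bs\<in>ordered_partitions (Suc k) (B - C).
       scale ((-1) ^ Suc k * of_nat (block_degree wt (last (C # Bs))) * of_nat (\<Prod>C\<leftarrow>C # Bs. block_N wt C))
         (\<phi> (concat (map sorted_list_of_set (C # Bs)))))"
      unfolding E by (auto simp: scale_sum_right mult_ac intro!: sum.cong)
  qed
  also have "\<dots> = (\<Sum>Bs\<in>ordered_partitions (Suc (Suc k)) B.
       scale ((-1) ^ Suc k * of_nat (block_degree wt (last Bs)) * of_nat (\<Prod>C\<leftarrow>Bs. block_N wt C))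
         (\<phi> (concat (map sorted_list_of_set Bs))))"
    by (rule sum_ordered_partitions_Suc[OF B, symmetric])
  finally show ?case unfolding E_def .
qed

lemma uword_append_pair:
  "uword (u @ [j, l]) = (0, foldr (*) (map val u) (val j * val l))"
  by (induction u) (simp_all add: umult_def)

text \<open>
  The letters \<open>0\<close> and \<open>Suc m\<close> stand for \<open>y\<close> and \<open>z\<close>. In the total weight only arrangements of all the
  letters have a nonzero coefficient, and of these only the ones that end in the two letters
  \<open>0\<close> and \<open>Suc m\<close>, since the commutator is the last factor of \<open>coeff_deviation_multilinear\<close>.
\<close>

lemma P_component:
  assumes "m \<ge> 1" and A: "A = {0..Suc m}"
  shows "scale 2 (snd (P (map (\<lambda>j. one_plus (wt j) (val j)) [1..<m+1])
      (one_plus (wt 0) (val 0)) (one_plus (wt (Suc m)) (val (Suc m))) (\<Sum>j\<in>A. wt j))) =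
    (\<Sum>k=1..m. \<Sum>Bs\<in>ordered_partitions k {1..m}.
       scale ((-1) ^ (k + 1) * of_nat (block_degree wt (last Bs)) * of_nat (\<Prod>B\<leftarrow>Bs. block_N wt B))
         (block_word val Bs (val 0 * val (Suc m) - val (Suc m) * val 0)))"
proof -
  define e where "e = (\<lambda>j. 1 + letter j :: (nat, 'k) series)"
  define D where "D = (\<Sum>j\<in>A. wt j)"
  define F where "F = loop_deviation (e 1) (map e [2..<m+1]) (e 0) (e (Suc m))"
  define X where "X = (letter_product [1..<m+1] :: (nat, 'k) series)"
  define C where "C = (letter 0 * letter (Suc m) - letter (Suc m) * letter 0 :: (nat, 'k) series)"
  define Z where "Z = (\<Sum>k<m. (1 - rderiv X) ^ k * (of_nat 2 * rderiv2 X))"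
  define x where "x = val 0 * val (Suc m) - val (Suc m) * val 0"
  have upt: "[1..<m+1] = 1 # [2..<m+1]"
    using assms(1) by (simp add: upt_conv_Cons numeral_2_eq_2 del: upt_Suc)
  have len: "length (1 # [2..<m+1]) = m" using assms(1) unfolding upt[symmetric] by simp
  have e0: "coeff (e j) [] = 1" for j by (simp add: e_def coeff_1)
  have const: "\<forall>u\<in>set (e 1 # map e [2..<m+1]) \<union> {e 0, e (Suc m)}. coeff u [] = 1"
    by (auto simp: e0)
  have ev: "eval (e j) = one_plus (wt j) (val j)" if "j \<in> A" for j
    unfolding e_def using that by (rule eval_one_plus_letter)
  have "map (\<lambda>j. one_plus (wt j) (val j)) [1..<m+1] = map (\<lambda>j. eval (e j)) [1..<m+1]"
    by (intro map_cong refl ev[symmetric]) (auto simp: A)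
  also have "\<dots> = eval (e 1) # map eval (map e [2..<m+1])"
    unfolding upt by simp
  finally have args: "map (\<lambda>j. one_plus (wt j) (val j)) [1..<m+1] = eval (e 1) # map eval (map e [2..<m+1])" .
  have P: "P (map (\<lambda>j. one_plus (wt j) (val j)) [1..<m+1]) (one_plus (wt 0) (val 0))
      (one_plus (wt (Suc m)) (val (Suc m))) = eval F"
  proof (unfold args)
    have "0 \<in> A" "Suc m \<in> A" by (simp_all add: A)
    then show "P (eval (e 1) # map eval (map e [2..<m+1])) (one_plus (wt 0) (val 0))
        (one_plus (wt (Suc m)) (val (Suc m))) = eval F"
      unfolding F_def P_eval[OF const, symmetric] by (simp only: ev)
  qed
  have AB: "A - {1..m} = {0, Suc m}" "A - {0, Suc m} = {1..m}"
  proof -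
    show "A - {1..m} = {0, Suc m}"
      by (rule set_eqI) (simp add: A, arith)
    show "A - {0, Suc m} = {1..m}"
      by (rule set_eqI) (simp add: A, arith)
  qed
  have setA: "set (1 # [2..<m+1] @ [0, Suc m]) = A"
  proof (rule set_eqI)
    show "j \<in> set (1 # [2..<m+1] @ [0, Suc m]) \<longleftrightarrow> j \<in> A" for j
      unfolding A using assms(1) by (simp del: upt_Suc) arith
  qed
  have mult2: "2 * coeff F w = coeff (Z * C) w" if w: "w \<in> arrangements A" for w
  proof -
    from setA have "distinct w" "set w = set (1 # [2..<m+1] @ [0, Suc m])"
      using w by (simp_all only: arrangements_def mem_Collect_eq)
    moreover have "distinct (1 # [2..<m+1] @ [0, Suc m])"
      using assms(1) by (simp del: upt_Suc)
    ultimately have "coeff F w = coeff (\<Sum>k<m. (1 - rderiv X) ^ k * (rderiv2 X * C)) w"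
      using coeff_deviation_multilinear[of 1 "[2..<m+1]" 0 "Suc m" w, where 'k = 'k]
      unfolding F_def e_def X_def C_def upt len by blast
    moreover have "Z * C = of_nat 2 * (\<Sum>k<m. (1 - rderiv X) ^ k * (rderiv2 X * C))"
      unfolding Z_def sum_distrib_right sum_distrib_left
      by (intro sum.cong refl) (simp only: mult.assoc[symmetric] mult_of_nat_commute[of 2 "_ ^ _"])
    ultimately show ?thesis
      using coeff_of_nat_times[of 2 "\<Sum>k<m. (1 - rderiv X) ^ k * (rderiv2 X * C)" w] by simp
  qed
  \<comment> \<open>A word that contains all the letters and has only their total weight cannot repeat any of them.\<close>
  have zero: "coeff F w = 0" if w: "w \<in> words D - arrangements A" for w
  proof (rule ccontr)
    assume nz: "coeff F w \<noteq> 0"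
    have "wt 0 \<le> D" unfolding D_def by (rule member_le_sum) (auto simp: A)
    then have "D > 0" using wt_pos[of 0] by (simp add: A)
    then have "w \<noteq> []" using w by (auto simp: words_def)
    then have "coeff (F - 1) w \<noteq> 0" using nz by (simp add: coeff_1)
    moreover have "involves {j} (F - 1)" if "j \<in> A" for j
      unfolding F_def
    proof (intro involves_loop_deviation const)
      have "e j \<in> set (e 1 # map e [2..<m+1]) \<union> {e 0, e (Suc m)}"
        using that unfolding setA[symmetric] by (auto simp del: upt_Suc)
      then show "\<exists>u\<in>set (e 1 # map e [2..<m+1]) \<union> {e 0, e (Suc m)}. restrict (- {j}) u = 1"
        by (rule bexI[rotated]) (simp add: e_def restrict_one_plus_letter)
    qed
    ultimately have "set w = A" using w unfolding involves_def words_def by blast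
    moreover from this have "distinct w"
      using w wt_pos by (intro distinct_if_weight_minimal[of w wt]) (auto simp: words_def D_def)
    ultimately show False using w by (simp add: arrangements_def)
  qed
  have "snd (eval F D) = (\<Sum>w\<in>words D. scale (coeff F w) (snd (uword w)))"
    by (simp add: eval_def snd_sum uscale_def)
  also have "\<dots> = (\<Sum>w\<in>arrangements A. scale (coeff F w) (snd (uword w)))"
    using zero by (intro sum.mono_neutral_right finite_words)
      (auto simp: arrangements_def words_def D_def weight_distinct)
  finally have "scale 2 (snd (eval F D)) = (\<Sum>w\<in>arrangements A. scale (coeff (Z * C) w) (snd (uword w)))"
    using mult2 by (simp add: scale_sum_right)
  also have "\<dots> = (\<Sum>w\<in>arrangements A. \<Sum>l\<le>length w. scale (coeff Z (take l w) * coeff C (drop l w)) (snd (uword (take l w @ drop l w))))"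
    by (simp only: coeff_times[of Z] scale_sum_left append_take_drop_id)
  also have "\<dots> = (\<Sum>B\<in>Pow A. \<Sum>u\<in>arrangements B. \<Sum>v\<in>arrangements (A - B).
      scale (coeff Z u * coeff C v) (snd (uword (u @ v))))"
    by (rule sum_arrangements_split) (simp add: A)
  also have "\<dots> = (\<Sum>B\<in>{{1..m}}. \<Sum>u\<in>arrangements B. \<Sum>v\<in>arrangements (A - B).
      scale (coeff Z u * coeff C v) (snd (uword (u @ v))))"
  proof (rule sum.mono_neutral_right)
    show "\<forall>B\<in>Pow A - {{1..m}}. (\<Sum>u\<in>arrangements B. \<Sum>v\<in>arrangements (A - B).
        scale (coeff Z u * coeff C v) (snd (uword (u @ v)))) = 0"
    proof (intro ballI sum.neutral)
      fix B u v assume B: "B \<in> Pow A - {{1..m}}" and v: "v \<in> arrangements (A - B)"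
      have "B = A - set v"
        using B v by (auto simp: arrangements_def)
      then have "set v \<noteq> {0, Suc m}"
        using B AB(2) by auto
      then have "v \<noteq> [0, Suc m]" "v \<noteq> [Suc m, 0]" by auto
      then have "coeff C v = 0"
        by (cases v rule: rev_cases) (auto simp: C_def coeff_times_letter)
      then show "scale (coeff Z u * coeff C v) (snd (uword (u @ v))) = 0" by simp
    qed
  qed (auto simp: A)
  also have "\<dots> = (\<Sum>u\<in>arrangements {1..m}. scale (coeff Z u) (foldr (*) (map val u) x))"
  proof -
    have "arrangements {0, Suc m} = {[0, Suc m], [Suc m, 0]}"
      by (rule arrangements_pair) simp
    then show ?thesis
      by (simp add: AB(1)[unfolded One_nat_def] uword_append_pair C_def coeff_times_letter x_def foldr_times_diff
          scale_right_diff_distrib sum.distrib sum_subtractf)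
  qed
  also have "\<dots> = (\<Sum>k<m. \<Sum>u\<in>arrangements {1..m}.
      scale (coeff ((1 - rderiv X) ^ k * (of_nat 2 * rderiv2 X)) u) (foldr (*) (map val u) x))"
    unfolding Z_def coeff_sum scale_sum_left by (rule sum.swap)
  also have "\<dots> = (\<Sum>k<m. \<Sum>Bs\<in>ordered_partitions (Suc k) {1..m}.
       scale ((-1) ^ k * of_nat (block_degree wt (last Bs)) * of_nat (\<Prod>B\<leftarrow>Bs. block_N wt B))
         (block_word val Bs x))"
    unfolding X_def block_word_def
    by (intro sum.cong[OF refl] sum_arrangements_eq_sum_ordered_partitions) simp
  also have "\<dots> = (\<Sum>k=1..m. \<Sum>Bs\<in>ordered_partitions k {1..m}.
       scale ((-1) ^ (k + 1) * of_nat (block_degree wt (last Bs)) * of_nat (\<Prod>B\<leftarrow>Bs. block_N wt B))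
         (block_word val Bs x))"
    by (simp add: sum.atLeast1_atMost_eq)
  finally show ?thesis
    unfolding P D_def[symmetric] x_def .
qed

end

section \<open>The Sabinin brackets\<close>

context graded_algebra
begin

lemma homogeneous_decomposition_component:
  "homogeneous_decomposition S x (\<lambda>n. component n x)"
  unfolding component_def using theI'[OF direct_sum_S] by simp

lemma component_eqI: "homogeneous_decomposition S x f \<Longrightarrow> component n x = f n"
  using direct_sum_S homogeneous_decomposition_component by (metis (full_types))

lemma component_S: "n \<ge> 1 \<Longrightarrow> component n x \<in> S n"
  and finite_degrees: "finite (degrees x)"
  and sum_components: "(\<Sum>n\<in>degrees x. component n x) = x"
  and degrees_pos: "n \<in> degrees x \<Longrightarrow> n \<ge> 1"
  using homogeneous_decomposition_component[of x] unfolding homogeneous_decomposition_def degrees_def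
  by (auto simp: Suc_le_eq intro: gr0I)

lemma component_homogeneous:
  assumes "n \<ge> 1" "x \<in> S n"
  shows "component l x = (if l = n then x else 0)"
proof (rule component_eqI)
  have "(\<Sum>l | (if l = n then x else 0) \<noteq> 0. if l = n then x else 0) = x"
    by (cases "x = 0") auto
  moreover have "{l. (if l = n then x else 0) \<noteq> 0} \<subseteq> {n}" by auto
  then have "finite {l. (if l = n then x else 0) \<noteq> 0}" by (rule finite_subset) simp
  ultimately show "homogeneous_decomposition S x (\<lambda>l. if l = n then x else 0)"
    using assms subspace_0[OF subspace_S] unfolding homogeneous_decomposition_def by auto
qed

lemma degrees_homogeneous: "n \<ge> 1 \<Longrightarrow> x \<in> S n \<Longrightarrow> degrees x = (if x = 0 then {} else {n})"
  by (auto simp: degrees_def component_homogeneous)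

definition partition_sum :: "nat \<Rightarrow> (nat \<Rightarrow> nat) \<Rightarrow> (nat \<Rightarrow> 'a) \<Rightarrow> 'a \<Rightarrow> 'a" where
  "partition_sum m i a x = (\<Sum>k = 1..m. \<Sum>Bs \<in> ordered_partitions k {1..m}.
     scale ((-1) ^ (k + 1) * of_nat (block_degree i (last Bs)) * of_nat (\<Prod>B\<leftarrow>Bs. block_N i B))
       (block_word a Bs x))"

lemma block_word_diff: "block_word a Bs (x - y) = block_word a Bs x - block_word a Bs y"
  by (simp add: block_word_def foldr_times_diff)

lemma partition_sum_diff: "partition_sum m i a (x - y) = partition_sum m i a x - partition_sum m i a y"
  unfolding partition_sum_def block_word_diff scale_right_diff_distrib sum_subtractf ..

lemma partition_sum_sum: "partition_sum m i a (\<Sum>t\<in>T. f t) = (\<Sum>t\<in>T. partition_sum m i a (f t))"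
proof -
  have "partition_sum m i a 0 = 0"
    using partition_sum_diff[of m i a 0 0] by simp
  moreover have "partition_sum m i a (x + y) = partition_sum m i a x + partition_sum m i a y" for x y
    using partition_sum_diff[of m i a "x + y" y] by (simp add: algebra_simps)
  ultimately show ?thesis
    by (induction T rule: infinite_finite_induct) auto
qed

lemma in_ordered_partitionsD: "Bs \<in> ordered_partitions k A \<Longrightarrow> B \<in> set Bs \<Longrightarrow> B \<subseteq> A"
  by (auto simp: ordered_partitions_def)

lemma partition_sum_cong:
  assumes "\<And>j. j \<in> {1..m} \<Longrightarrow> i j = i' j" "\<And>j. j \<in> {1..m} \<Longrightarrow> a j = a' j"
  shows "partition_sum m i a x = partition_sum m i' a' x"
  unfolding partition_sum_def
proof (intro sum.cong refl)
  fix k Bs assume k: "k \<in> {1..m}" and Bs: "Bs \<in> ordered_partitions k {1..m}"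
  have deg: "block_degree i B = block_degree i' B" and N: "block_N i B = block_N i' B"
    if "B \<in> set Bs" for B
    using in_ordered_partitionsD[OF Bs that] assms(1)
    by (auto simp: block_degree_def block_N_def subset_iff intro!: sum.cong prod.cong)
  have "Bs \<noteq> []" using k Bs by (auto simp: ordered_partitions_def)
  then have "block_degree i (last Bs) = block_degree i' (last Bs)"
    using deg by simp
  moreover have "map (block_N i) Bs = map (block_N i') Bs"
    using N by simp
  moreover have "set (sorted_list_of_set B) \<subseteq> {1..m}" if "B \<in> set Bs" for B
    using in_ordered_partitionsD[OF Bs that] finite_subset[of B "{1..m}"] by simp
  then have "map a (concat (map sorted_list_of_set Bs)) = map a' (concat (map sorted_list_of_set Bs))"
    using assms(2) by (intro map_cong refl) (auto simp: subset_iff)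
  ultimately show "scale ((-1) ^ (k + 1) * of_nat (block_degree i (last Bs)) * of_nat (\<Prod>B\<leftarrow>Bs. block_N i B))
       (block_word a Bs x) =
     scale ((-1) ^ (k + 1) * of_nat (block_degree i' (last Bs)) * of_nat (\<Prod>B\<leftarrow>Bs. block_N i' B))
       (block_word a' Bs x)"
    unfolding block_word_def by (simp only:)
qed

lemma partition_sum_eq_0:
  assumes "j \<in> {1..m}" "a j = 0"
  shows "partition_sum m i a x = 0"
  unfolding partition_sum_def
proof (intro sum.neutral ballI)
  fix k Bs assume "Bs \<in> ordered_partitions k {1..m}"
  then have U: "\<Union>(set Bs) = {1..m}" by (simp add: ordered_partitions_def)
  then obtain B where B: "B \<in> set Bs" "j \<in> B" using assms(1) by blast
  have "B \<subseteq> {1..m}" using U B by blast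
  then have "finite B" by (rule finite_subset) simp
  then have "0 \<in> set (map a (concat (map sorted_list_of_set Bs)))"
    using B assms(2) by (force simp: image_iff)
  moreover have "foldr (*) ws x = 0" if "0 \<in> set ws" for ws
    using that by (induction ws) auto
  ultimately show "scale ((-1) ^ (k + 1) * of_nat (block_degree i (last Bs)) * of_nat (\<Prod>B\<leftarrow>Bs. block_N i B))
       (block_word a Bs x) = 0"
    unfolding block_word_def by simp
qed

lemma P_homogeneous:
  assumes "m \<ge> 1" and a: "\<And>t. t \<in> {1..m} \<Longrightarrow> i t \<ge> 1 \<and> a t \<in> S (i t)"
    and y: "j \<ge> 1" "y \<in> S j" and z: "k \<ge> 1" "z \<in> S k"
  shows "scale 2 (snd (P (map (\<lambda>t. one_plus (i t) (a t)) [1..<m+1]) (one_plus j y) (one_plus k z)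
      (sum_list (map i [1..<m+1]) + j + k))) = partition_sum m i a (y * z - z * y)"
proof -
  define wt where "wt = i(0 := j, Suc m := k)"
  define val where "val = a(0 := y, Suc m := z)"
  interpret numbered_graded_valuation scale S wt "{0..Suc m}" val
  proof unfold_locales
    fix t assume "t \<in> {0..Suc m}"
    then consider "t = 0" | "t = Suc m" | "t \<in> {1..m}" by fastforce
    then show "wt t \<ge> 1" "val t \<in> S (wt t)"
      by (cases; use a y z in \<open>auto simp: wt_def val_def\<close>)+
  qed simp
  have ends: "wt 0 = j" "wt (Suc m) = k" "val 0 = y" "val (Suc m) = z"
    by (simp_all add: wt_def val_def)
  have middle: "map (\<lambda>t. one_plus (wt t) (val t)) [1..<m+1] = map (\<lambda>t. one_plus (i t) (a t)) [1..<m+1]"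
    by (rule map_cong) (auto simp: wt_def val_def)
  have total: "(\<Sum>t\<in>{0..Suc m}. wt t) = sum_list (map i [1..<m+1]) + j + k"
  proof -
    have "(\<Sum>t\<in>{0..Suc m}. wt t) = wt 0 + (\<Sum>t\<in>{1..m}. wt t) + wt (Suc m)"
      by (simp add: sum.atLeast_Suc_atMost[of 0 m])
    also have "(\<Sum>t\<in>{1..m}. wt t) = (\<Sum>t\<in>{1..m}. i t)"
      by (rule sum.cong) (auto simp: wt_def)
    also have "\<dots> = sum_list (map i [1..<m+1])"
      by (simp add: sum_list_distinct_conv_sum_set atLeastLessThanSuc_atLeastAtMost del: upt_Suc)
    finally show ?thesis by (simp add: wt_def del: upt_Suc)
  qed
  have cong: "partition_sum m wt val x = partition_sum m i a x" for x
    by (rule partition_sum_cong) (auto simp: wt_def val_def)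
  show ?thesis
    using P_component[OF assms(1) refl] unfolding partition_sum_def[symmetric] middle total cong ends .
qed

text \<open>
  Both sides are biadditive in \<open>y\<close> and \<open>z\<close>, which reduces the claim to homogeneous \<open>y\<close> and \<open>z\<close>. If some
  \<open>a t\<close> is \<open>0\<close>, then it has no degrees and \<open>p\<close> is an empty sum, while each word on the right contains \<open>a t\<close>.
\<close>

lemma p_eq_partition_sum:
  assumes "m \<ge> 1" and a: "\<And>t. t \<in> {1..m} \<Longrightarrow> i t \<ge> 1 \<and> a t \<in> S (i t)"
  shows "scale 2 (p (map a [1..<m+1]) y z) = partition_sum m i a (y * z - z * y)"
proof (cases "\<exists>t\<in>{1..m}. a t = 0")
  case True
  then obtain t where t: "t \<in> {1..m}" "a t = 0" by blast
  have "listset Xs = {}" if "{} \<in> set Xs" for Xs :: "nat set list"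
    using that by (induction Xs) (auto simp: set_Cons_def)
  moreover have "{} \<in> set (map degrees (map a [1..<m+1]))"
    using t degrees_homogeneous[of 1 0] subspace_0[OF subspace_S, of 1]
    by (force simp: image_iff simp del: upt_Suc)
  ultimately have "p (map a [1..<m+1]) y z = 0"
    unfolding p_def by simp
  then show ?thesis using partition_sum_eq_0[of t m a, OF t] by simp
next
  case False
  have deg: "degrees (a t) = {i t}" and comp: "component (i t) (a t) = a t" if "t \<in> {1..m}" for t
    using False a[OF that] that degrees_homogeneous[of "i t" "a t"] component_homogeneous[of "i t" "a t"] by auto
  have "map degrees (map a [1..<m+1]) = map (\<lambda>t. {i t}) [1..<m+1]"
    using deg by (auto simp del: upt_Suc)
  moreover have "listset (map (\<lambda>t. {i t}) js) = {map i js}" for js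
    by (induction js) (auto simp: set_Cons_def)
  ultimately have "listset (map degrees (map a [1..<m+1])) = {map i [1..<m+1]}"
    by metis
  moreover have "map2 (\<lambda>d x. one_plus d (component d x)) (map i [1..<m+1]) (map a [1..<m+1]) =
      map (\<lambda>t. one_plus (i t) (a t)) [1..<m+1]"
    using comp by (auto simp: map2_map_map simp del: upt_Suc)
  ultimately have p: "p (map a [1..<m+1]) y z = (\<Sum>j\<in>degrees y. \<Sum>k\<in>degrees z.
      snd (P (map (\<lambda>t. one_plus (i t) (a t)) [1..<m+1]) (one_plus j (component j y))
        (one_plus k (component k z)) (sum_list (map i [1..<m+1]) + j + k)))"
    unfolding p_def by (simp del: upt_Suc)
  have "scale 2 (p (map a [1..<m+1]) y z) = (\<Sum>j\<in>degrees y. \<Sum>k\<in>degrees z.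
      partition_sum m i a (component j y * component k z - component k z * component j y))"
    unfolding p scale_sum_right
    by (intro sum.cong refl P_homogeneous[OF assms] degrees_pos component_S)
  also have "\<dots> = partition_sum m i a ((\<Sum>j\<in>degrees y. \<Sum>k\<in>degrees z.
      component j y * component k z) - (\<Sum>j\<in>degrees y. \<Sum>k\<in>degrees z. component k z * component j y))"
    by (simp only: partition_sum_sum[symmetric] sum_subtractf)
  also have "(\<Sum>j\<in>degrees y. \<Sum>k\<in>degrees z. component j y * component k z) = y * z"
    by (simp only: sum_product[symmetric] sum_components)
  also have "(\<Sum>j\<in>degrees y. \<Sum>k\<in>degrees z. component k z * component j y) = z * y"
    by (simp only: sum_distrib_left[symmetric] sum_distrib_right[symmetric] sum_components)
  finally show ?thesis .
qed

text \<open>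
  The right-hand side of \<open>p_eq_partition_sum\<close> is antisymmetric in \<open>y\<close> and \<open>z\<close>, so the difference that
  defines the bracket doubles it and cancels the factor \<open>2\<close>.
\<close>

lemma sabinin_bracket_eq_partition_sum:
  assumes "m \<ge> 1" and "\<And>t. t \<in> {1..m} \<Longrightarrow> i t \<ge> 1 \<and> a t \<in> S (i t)"
  shows "sabinin_bracket (map a [1..<m+1]) b c = partition_sum m i a (c * b - b * c)"
proof -
  have "partition_sum m i a (b * c - c * b) = - partition_sum m i a (c * b - b * c)"
    by (simp add: partition_sum_diff)
  then have "scale 2 (sabinin_bracket (map a [1..<m+1]) b c) =
      partition_sum m i a (c * b - b * c) + partition_sum m i a (c * b - b * c)"
    using p_eq_partition_sum[OF assms] unfolding sabinin_bracket_def scale_right_diff_distrib by simp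
  also have "\<dots> = scale 2 (partition_sum m i a (c * b - b * c))"
    using scale_left_distrib[of 1 1 "partition_sum m i a (c * b - b * c)"] by simp
  finally show ?thesis by simp
qed

end

theorem theorem4p3:
  fixes scale :: "'k::field_char_0 \<Rightarrow> 'a::ring \<Rightarrow> 'a"
    and S :: "nat \<Rightarrow> 'a set"
    and m :: nat and i :: "nat \<Rightarrow> nat" and a :: "nat \<Rightarrow> 'a" and b c :: 'a
  assumes "graded_algebra scale S"
    and "m \<ge> 1"
    and "\<And>j. j \<in> {1..m} \<Longrightarrow> i j \<ge> 1 \<and> a j \<in> S (i j)"
  shows "graded_algebra.sabinin_bracket scale S (map a [1..<m+1]) b c =
    (\<Sum>k = 1..m. \<Sum>Bs \<in> ordered_partitions k {1..m}.
       scale ((-1) ^ (k + 1) * of_nat (block_degree i (last Bs)) * of_nat (\<Prod>B\<leftarrow>Bs. block_N i B))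
         (block_word a Bs (c * b - b * c)))"
  using graded_algebra.sabinin_bracket_eq_partition_sum[OF assms]
    graded_algebra.partition_sum_def[OF assms(1)] by simp

end
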